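(* Let $n \ge 2$, let $w \in \mathfrak{S}_n$ be a fully supported permutation, and let $1 \le k \le n-1$. Then the following are equivalent: (i) $\{k,k+1\}$ is a forced left-perimeter tile for $w$; (ii) $w^{-1}(k) > w^{-1}(k+1)$, and $k$ and $k+1$ do not appear together in a $321$-pattern of $w$; (iii) $k+1$ is a left-to-right maximum of $w$ and $k$ is a right-to-left minimum of $w$.
   Context: Permutations are written in one-line notation $w = w(1)w(2)\cdots w(n)$. A permutation $w \in \mathfrak{S}_n$ is fully supported if $\{w(1),\ldots,w(r)\} \ne \{1,\ldots,r\}$ for all $1 \le r < n$ (equivalently, every simple reflection appears in its reduced decompositions). Elnitsky polygon. For fully supported $w \in \mathfrak{S}_n$, $n \ge 2$, Elnitsky's polygon $X(w)$ is the equilateral $2n$-gon whose sides, read counterclockwise starting at the top vertex, are labeled $1,\ldots,n,w(n),\ldots,w(1)$, such that the first $n$ sides form half of a convex $2n$-gon and sides with the same label are parallel. Concretely: fix unit vectors $v_1,\ldots,v_n$ in the plane with angles $\pi < \theta_1 < \cdots < \theta_n < 2\pi$; with the top vertex at the origin, the leftside boundary is the path with vertices $v_1+\cdots+v_k$ ($0\le k\le n$), its $k$th edge labeled $k$, and the rightside boundary is the path with vertices $v_{w(1)}+\cdots+v_{w(k)}$ ($0 \le k \le n$), its $k$th edge labeled $w(k)$. Both paths end at the bottom vertex, and $X(w)$ is the region they bound. Tilings. A rhombic tiling of $X(w)$ is an (edge-to-edge) tiling by rhombi whose edges are all congruent and parallel to edges of $X(w)$ (unit rhombi with sides parallel to $v_i$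 and $v_j$, $i \ne j$). $T(w)$ is the set of all rhombic tilings of $X(w)$. The labels of a tile are the labels $\{i,j\}$ of the sides of $X(w)$ to which its edges are parallel. In any tiling no two tiles have the same labels, so a tile is identified with its label set: "the tile $\{x,y\}$". Perimeter tiles. A tile of $T \in T(w)$ is a left-perimeter tile if it shares two consecutive edges with the leftside boundary of $X(w)$. The tile $\{x,y\}$ is a forced left-perimeter tile for $w$ if in every $T \in T(w)$ the tile $\{x,y\}$ is present and is a left-perimeter tile. Patterns. A $321$-pattern in $w$ is a triple of values $w(i)>w(j)>w(l)$ with $i<j<l$; two values appear together in a $321$-pattern if both belong to some such triple. A left-to-right maximum of $w$ is a value $w(i)$ with $w(i) > w(j)$ for all $j<i$; a right-to-left minimum is a value $w(i)$ with $w(i) < w(j)$ for all $j > i$. *)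

theory Defs
  imports "HOL-Analysis.Analysis" "HOL-Combinatorics.Permutations"
begin

text \<open>
  Permutations of size \<open>n\<close> are functions \<open>w :: nat \<Rightarrow> nat\<close> with \<open>w permutes {1..n}\<close>;
  the plane is the type of complex numbers.
\<close>

definition fully_supported :: "nat \<Rightarrow> (nat \<Rightarrow> nat) \<Rightarrow> bool" where
  "fully_supported n w \<longleftrightarrow> (\<forall>r. 1 \<le> r \<and> r < n \<longrightarrow> w ` {1..r} \<noteq> {1..r})"


subsection \<open>Elnitsky's polygon\<close>

text \<open>The unit vector with label \<open>i\<close> is \<open>cis (\<theta> i)\<close>.\<close>

definition admissible_angles :: "nat \<Rightarrow> (nat \<Rightarrow> real) \<Rightarrow> bool" where
  "admissible_angles n \<theta> \<longleftrightarrow>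
     (\<forall>i\<in>{1..n}. pi < \<theta> i \<and> \<theta> i < 2 * pi) \<and> strict_mono_on {1..n} \<theta>"

text \<open>
  The path that starts at the origin (the top vertex) and whose \<open>k\<close>th edge is labeled \<open>u k\<close>.
  The leftside boundary is the case \<open>u = id\<close>, the rightside boundary the case \<open>u = w\<close>.
\<close>

definition path_vertex :: "(nat \<Rightarrow> real) \<Rightarrow> (nat \<Rightarrow> nat) \<Rightarrow> nat \<Rightarrow> complex" where
  "path_vertex \<theta> u k = (\<Sum>i=1..k. cis (\<theta> (u i)))"

definition path_edge :: "(nat \<Rightarrow> real) \<Rightarrow> (nat \<Rightarrow> nat) \<Rightarrow> nat \<Rightarrow> complex set" where
  "path_edge \<theta> u k = closed_segment (path_vertex \<theta> u (k - 1)) (path_vertex \<theta> u k)"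

definition polygon_boundary :: "nat \<Rightarrow> (nat \<Rightarrow> real) \<Rightarrow> (nat \<Rightarrow> nat) \<Rightarrow> complex set" where
  "polygon_boundary n \<theta> w =
     (\<Union>k\<in>{1..n}. path_edge \<theta> id k) \<union> (\<Union>k\<in>{1..n}. path_edge \<theta> w k)"

definition elnitsky_polygon :: "nat \<Rightarrow> (nat \<Rightarrow> real) \<Rightarrow> (nat \<Rightarrow> nat) \<Rightarrow> complex set" where
  "elnitsky_polygon n \<theta> w = polygon_boundary n \<theta> w \<union> inside (polygon_boundary n \<theta> w)"


subsection \<open>Rhombic tilings\<close>

definition rhombus :: "(nat \<Rightarrow> real) \<Rightarrow> complex \<Rightarrow> nat \<Rightarrow> nat \<Rightarrow> complex set" where
  "rhombus \<theta> p i j =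
     convex hull {p, p + cis (\<theta> i), p + cis (\<theta> j), p + cis (\<theta> i) + cis (\<theta> j)}"

definition tile_with_labels ::
    "nat \<Rightarrow> (nat \<Rightarrow> real) \<Rightarrow> nat \<Rightarrow> nat \<Rightarrow> complex set \<Rightarrow> bool" where
  "tile_with_labels n \<theta> i j R \<longleftrightarrow>
     i \<in> {1..n} \<and> j \<in> {1..n} \<and> i \<noteq> j \<and> (\<exists>p. R = rhombus \<theta> p i j)"

text \<open>The last condition says that the tiling is edge-to-edge.\<close>

definition rhombic_tilings ::
    "nat \<Rightarrow> (nat \<Rightarrow> real) \<Rightarrow> (nat \<Rightarrow> nat) \<Rightarrow> complex set set set" where
  "rhombic_tilings n \<theta> w =
     {T. finite T \<and>
         (\<forall>R\<in>T. \<exists>i j. tile_with_labels n \<theta> i j R) \<and>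
         \<Union>T = elnitsky_polygon n \<theta> w \<and>
         pairwise (\<lambda>R S. interior R \<inter> interior S = {}) T \<and>
         (\<forall>R\<in>T. \<forall>S\<in>T. (R \<inter> S) face_of R \<and> (R \<inter> S) face_of S)}"

definition left_perimeter_tile :: "nat \<Rightarrow> (nat \<Rightarrow> real) \<Rightarrow> complex set \<Rightarrow> bool" where
  "left_perimeter_tile n \<theta> R \<longleftrightarrow>
     (\<exists>m. 1 \<le> m \<and> m < n \<and> path_edge \<theta> id m edge_of R \<and> path_edge \<theta> id (m + 1) edge_of R)"

definition forced_left_perimeter_tile ::
    "nat \<Rightarrow> (nat \<Rightarrow> real) \<Rightarrow> (nat \<Rightarrow> nat) \<Rightarrow> nat \<Rightarrow> nat \<Rightarrow> bool" where
  "forced_left_perimeter_tile n \<theta> w x y \<longleftrightarrow>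
     (\<forall>T\<in>rhombic_tilings n \<theta> w.
        \<exists>R\<in>T. tile_with_labels n \<theta> x y R \<and> left_perimeter_tile n \<theta> R)"


subsection \<open>Patterns\<close>

definition together_in_321 :: "nat \<Rightarrow> (nat \<Rightarrow> nat) \<Rightarrow> nat \<Rightarrow> nat \<Rightarrow> bool" where
  "together_in_321 n w x y \<longleftrightarrow>
     (\<exists>i j l. 1 \<le> i \<and> i < j \<and> j < l \<and> l \<le> n \<and> w i > w j \<and> w j > w l \<and>
        x \<in> {w i, w j, w l} \<and> y \<in> {w i, w j, w l})"

text \<open>Here \<open>x\<close> is a value of \<open>w\<close>, not a position.\<close>

definition left_to_right_maximum :: "nat \<Rightarrow> (nat \<Rightarrow> nat) \<Rightarrow> nat \<Rightarrow> bool" where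
  "left_to_right_maximum n w x \<longleftrightarrow>
     (\<exists>i\<in>{1..n}. x = w i \<and> (\<forall>j\<in>{1..n}. j < i \<longrightarrow> w i > w j))"

definition right_to_left_minimum :: "nat \<Rightarrow> (nat \<Rightarrow> nat) \<Rightarrow> nat \<Rightarrow> bool" where
  "right_to_left_minimum n w x \<longleftrightarrow>
     (\<exists>i\<in>{1..n}. x = w i \<and> (\<forall>j\<in>{1..n}. j > i \<longrightarrow> w i < w j))"

end

(*
  A path with edge vectors of negative imaginary part is the graph of a function of the depth, which
  turns the polygon into the region between two functions.  Passing from u to w in the weak order moves
  the path to the right, strictly so wherever the two paths do not use the same labels.

  If condition (ii) fails, a tiling without the tile in question arises from a chain of adjacent
  swaps from the identity to w that swaps k and k+1 only when nothing else is left to do.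

  Conversely, every tiling can be dismantled from the left: walking down the left boundary from the first
  place where it leaves the right one, the tiles along its edges hang from the upper endpoints of these
  edges until one of them contains two consecutive edges, and removing that tile swaps two adjacent
  labels.  So every tiling comes from a chain of swaps, and if k+1 is a left-to-right maximum and k a
  right-to-left minimum, the first swap that involves k or k+1 is the swap of these two.
*)

theory Submission
  imports Defs
begin

subsection \<open>The weak order\<close>

text \<open>The definitions speak of point sets: \<open>inside\<close>, interiors, faces. They
  become combinatorial by splitting a path at depth \<open>y\<close> by labels, each label holding
  the part of its edge above that depth. All paths distribute the same total \<open>y\<close>; going
  up the weak order moves amounts to larger labels, which have larger slopes. If nothing is moved,
  the finished labels agree, so comparable paths touch only in common vertices and edges. This one
  fact gives the shape of the polygon, makes tiles meet in faces and locates the tiles on the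
  leftside boundary.

  The dismantling cannot start from the weak order: a tiling only shows which path lies to the left,
  and the order is known only after all tiles are gone. The region that remains may be pinched
  wherever the paths meet, so it is not again an Elnitsky polygon, and the induction asks only for
  the points strictly between the paths to be covered.

  Full support is used twice: no pinch occurs between top and bottom of the polygon itself, and
  extremality of k + 1 and k forces k + 1 to precede k.\<close>

definition weak_le :: "nat \<Rightarrow> (nat \<Rightarrow> nat) \<Rightarrow> (nat \<Rightarrow> nat) \<Rightarrow> bool" where
  "weak_le n u w \<longleftrightarrow>
     (\<forall>a\<in>{1..n}. \<forall>b\<in>{1..n}. a < b \<and> inv u b < inv u a \<longrightarrow> inv w b < inv w a)"

definition swap_at :: "nat \<Rightarrow> (nat \<Rightarrow> nat) \<Rightarrow> nat \<Rightarrow> nat" where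
  "swap_at i u = u \<circ> Transposition.transpose i (Suc i)"

lemma weak_le_refl: "weak_le n u u"
  by (simp add: weak_le_def)

lemma weak_le_trans: "weak_le n u v \<Longrightarrow> weak_le n v w \<Longrightarrow> weak_le n u w"
  by (simp add: weak_le_def)

lemma weak_le_id: "weak_le n id w"
  by (simp add: weak_le_def)

lemma weak_leD:
  "weak_le n u w \<Longrightarrow> a \<in> {1..n} \<Longrightarrow> b \<in> {1..n} \<Longrightarrow> a < b \<Longrightarrow> inv u b < inv u a \<Longrightarrow> inv w b < inv w a"
  by (simp add: weak_le_def)

lemma swap_at_permutes:
  assumes "u permutes {1..n}" "1 \<le> i" "i < n"
  shows "swap_at i u permutes {1..n}"
  unfolding swap_at_def using assms
  by (intro permutes_compose permutes_swap_id) auto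

lemma inv_swap_at:
  assumes "u permutes {1..n}"
  shows "inv (swap_at i u) l = Transposition.transpose i (Suc i) (inv u l)"
proof -
  have "bij u" using assms permutes_bij by blast
  then show ?thesis by (simp add: swap_at_def o_inv_distrib)
qed

lemma inv_in_interval:
  assumes "u permutes {1..n::nat}" "l \<in> {1..n}"
  shows "inv u l \<in> {1..n}"
  using assms permutes_in_image permutes_inv by metis

text \<open>Swapping neighbouring positions changes the relative order of the two values there only,
  and these were ascending, so no inversion is lost.\<close>

lemma weak_le_swap_at:
  assumes u: "u permutes {1..n}" and i: "1 \<le> i" "i < n" and asc: "u i < u (Suc i)"
  shows "weak_le n u (swap_at i u)"
  unfolding weak_le_def
proof (intro ballI impI, elim conjE)
  fix a b assume ab: "a < b" "inv u b < inv u a"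
  have "\<not> (inv u b = i \<and> inv u a = Suc i)"
    using ab asc permutes_inverses(1)[OF u] by (metis less_asym)
  then show "inv (swap_at i u) b < inv (swap_at i u) a"
    using ab by (auto simp: inv_swap_at[OF u] Transposition.transpose_def)
qed

text \<open>The only inversion that the swap can create is that of the two exchanged values, so a
  single inversion of \<open>w\<close> has to be checked.\<close>

lemma swap_at_weak_le:
  assumes u: "u permutes {1..n}" and uw: "weak_le n u w"
    and inv: "inv w (u (Suc i)) < inv w (u i)"
  shows "weak_le n (swap_at i u) w"
  unfolding weak_le_def
proof (intro ballI impI, elim conjE)
  fix a b assume ab: "a \<in> {1..n}" "b \<in> {1..n}" "a < b" "inv (swap_at i u) b < inv (swap_at i u) a"
  show "inv w b < inv w a"
  proof (cases "inv u b < inv u a")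
    case True then show ?thesis using ab weak_leD[OF uw] by blast
  next
    case False
    then have "inv u a = i" "inv u b = Suc i"
      using ab by (auto simp: inv_swap_at[OF u] Transposition.transpose_def split: if_splits)
    then have "a = u i" "b = u (Suc i)" using permutes_inverses(1)[OF u] by metis+
    then show ?thesis using inv by simp
  qed
qed

text \<open>The inversions still to be created on the way from \<open>u\<close> to \<open>w\<close>.
  An admissible swap creates one of them and loses none, so their number is the measure of the
  induction that builds a tiling.\<close>

definition missing :: "nat \<Rightarrow> (nat \<Rightarrow> nat) \<Rightarrow> (nat \<Rightarrow> nat) \<Rightarrow> (nat \<times> nat) set" where
  "missing n u w = {(a, b) \<in> {1..n} \<times> {1..n}. a < b \<and> inv w b < inv w a \<and> inv u a < inv u b}"

lemma card_missing_swap_at: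
  assumes u: "u permutes {1..n}" and i: "1 \<le> i" "i < n" and asc: "u i < u (Suc i)"
    and inv: "inv w (u (Suc i)) < inv w (u i)"
  shows "card (missing n (swap_at i u) w) < card (missing n u w)"
proof (rule psubset_card_mono)
  show "finite (missing n u w)"
    by (rule finite_subset[of _ "{1..n} \<times> {1..n}"]) (auto simp: missing_def)
  have "missing n (swap_at i u) w \<subseteq> missing n u w"
  proof
    fix x assume "x \<in> missing n (swap_at i u) w"
    then obtain a b where x: "x = (a, b)" and ab: "a \<in> {1..n}" "b \<in> {1..n}" "a < b"
      "inv w b < inv w a" and lt: "inv (swap_at i u) a < inv (swap_at i u) b"
      by (auto simp: missing_def)
    have "\<not> inv u b < inv u a"
      using weak_leD[OF weak_le_swap_at[OF u i asc] ab(1-3)] lt by force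
    moreover have "inv u a \<noteq> inv u b"
      using ab(3) permutes_inverses(1)[OF u] by (metis less_irrefl)
    ultimately show "x \<in> missing n u w" using x ab by (simp add: missing_def)
  qed
  moreover have "(u i, u (Suc i)) \<in> missing n u w"
    using i asc inv permutes_in_image[OF u, of i] permutes_in_image[OF u, of "Suc i"]
    by (auto simp: missing_def permutes_inverses(2)[OF u])
  moreover have "(u i, u (Suc i)) \<notin> missing n (swap_at i u) w"
    by (auto simp: missing_def inv_swap_at[OF u] permutes_inverses(2)[OF u])
  ultimately show "missing n (swap_at i u) w \<subset> missing n u w" by blast
qed

lemma increasing_interval:
  fixes g :: "nat \<Rightarrow> nat"
  assumes "\<And>i. a \<le> i \<Longrightarrow> i < b \<Longrightarrow> g i < g (Suc i)" "a \<le> i" "i < j" "j \<le> b"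
  shows "g i < g j"
  using assms(3,4)
proof (induction j)
  case (Suc j)
  then show ?case using assms(1)[of j] assms(2) by (cases "i = j") auto
qed simp

lemma permutes_increasing_id:
  assumes g: "g permutes {1..n::nat}"
    and inc: "\<And>i. 1 \<le> i \<Longrightarrow> i < n \<Longrightarrow> g i < g (Suc i)"
  shows "g = id"
proof -
  have "g i = i" if "i \<in> {1..n}" for i
  proof -
    have lower: "i \<le> n \<Longrightarrow> 1 \<le> i \<Longrightarrow> i \<le> g i" for i
    proof (induction i)
      case (Suc i)
      then show ?case
        using inc[of i] permutes_in_image[OF g, of 1] by (cases "i = 0") auto
    qed simp
    \<comment> \<open>Mirror image of the lower bound: \<open>j\<close> counts positions from the
      right end, where \<open>g n \<le> n\<close>.\<close>
    have upper: "j < n \<Longrightarrow> g (n - j) \<le> n - j" for j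
    proof (induction j)
      case 0 then show ?case using permutes_in_image[OF g, of n] by auto
    next
      case (Suc j)
      then have "Suc (n - Suc j) = n - j" by simp
      moreover have "1 \<le> n - Suc j" "n - Suc j < n" using Suc.prems by auto
      ultimately show ?case using inc[of "n - Suc j"] Suc by simp
    qed
    show ?thesis using lower[of i] upper[of "n - i"] that by auto
  qed
  moreover have "g i = i" if "i \<notin> {1..n}" for i using g that by (rule permutes_not_in)
  ultimately show ?thesis by fastforce
qed

text \<open>The admissible adjacent swaps that do not create a tile \<open>{k, k+1}\<close> on the left boundary.\<close>

definition avoiding :: "nat \<Rightarrow> (nat \<Rightarrow> nat) \<Rightarrow> nat \<Rightarrow> bool" where
  "avoiding k u i \<longleftrightarrow> \<not> (u i = k \<and> u (Suc i) = Suc k \<and> u ` {1..<i} = {1..<k})"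

lemma prefix_interval_card:
  assumes u: "u permutes {1..n}" and "u ` {1..<i} = {1..<k::nat}" "1 \<le> i" "1 \<le> k"
  shows "i = k"
proof -
  have "card (u ` {1..<i}) = card {1..<i}"
    using u by (intro card_image) (metis inj_on_subset permutes_inj subset_UNIV)
  then show ?thesis using assms by simp
qed

text \<open>\<open>inv w \<circ> u\<close> lists the positions in \<open>w\<close> of the successive
  values of \<open>u\<close>; where \<open>u\<close> ascends, a descent of this list is an
  admissible swap. If only the forbidden swap is left, the list has its single descent at
  \<open>k\<close>, and the first \<open>k - 1\<close> values of \<open>u\<close> are those below
  \<open>k\<close>. So in \<open>w\<close> all values below \<open>k\<close> precede
  \<open>k\<close> and all values above \<open>k + 1\<close> follow \<open>k + 1\<close>, which the
  third value of a 321-pattern through \<open>k\<close> and \<open>k + 1\<close>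
  contradicts.\<close>

lemma exists_avoiding_swap:
  assumes u: "u permutes {1..n}" and w: "w permutes {1..n}" and uw: "weak_le n u w"
    and ne: "u \<noteq> w" and k: "1 \<le> k" "k < n"
    and bad: "\<not> (inv w (Suc k) < inv w k \<and> \<not> together_in_321 n w k (Suc k))"
  shows "\<exists>i. 1 \<le> i \<and> i < n \<and> u i < u (Suc i) \<and> inv w (u (Suc i)) < inv w (u i) \<and> avoiding k u i"
proof (rule ccontr)
  assume no: "\<not> ?thesis"
  define g where "g = inv w \<circ> u"
  have g: "g permutes {1..n}" unfolding g_def by (intro permutes_compose u permutes_inv w)
  have inc: "g i < g (Suc i)"
    if i: "1 \<le> i" "i < n" and av: "u i < u (Suc i) \<Longrightarrow> g (Suc i) < g i \<Longrightarrow> avoiding k u i" for i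
  proof -
    have ne': "g i \<noteq> g (Suc i)" using permutes_inj[OF g] by (metis injD n_not_Suc_n)
    have neu: "u i \<noteq> u (Suc i)" using permutes_inj[OF u] by (metis injD n_not_Suc_n)
    show ?thesis
    proof (cases "u i < u (Suc i)")
      case True
      then show ?thesis using no i av ne' by (force simp: g_def)
    next
      \<comment> \<open>A descent of \<open>u\<close> is an inversion, which \<open>w\<close>
        shares, so \<open>g\<close> ascends here.\<close>
      case False
      then show ?thesis
        using i neu permutes_in_image[OF u, of i] permutes_in_image[OF u, of "Suc i"]
          weak_leD[OF uw, of "u (Suc i)" "u i"]
        by (simp add: g_def permutes_inverses(2)[OF u])
    qed
  qed
  show False
  proof (cases "\<forall>i. 1 \<le> i \<and> i < n \<longrightarrow> u i < u (Suc i) \<longrightarrow> g (Suc i) < g i \<longrightarrow> avoiding k u i")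
    case True
    then have "g = id" using inc by (intro permutes_increasing_id[OF g]) blast
    then have "w \<circ> g = w" by simp
    then have "u = w" by (simp add: g_def fun_eq_iff permutes_inverses(1)[OF w])
    then show False using ne by simp
  next
    case False
    then obtain i where i: "1 \<le> i" "i < n" "g (Suc i) < g i" "\<not> avoiding k u i" by blast
    then have pre: "u i = k" "u (Suc i) = Suc k" "u ` {1..<i} = {1..<k}"
      by (auto simp: avoiding_def)
    have ik: "i = k" using prefix_interval_card[OF u pre(3)] i k by simp
    have other: "g j < g (Suc j)" if "1 \<le> j" "j < n" "j \<noteq> k" for j
    proof (rule inc)
      assume "u j < u (Suc j)" "g (Suc j) < g j"
      show "avoiding k u j"
      proof (rule ccontr)
        assume "\<not> avoiding k u j"
        then have "u j = u i" using pre by (simp add: avoiding_def)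
        then show False using permutes_inj[OF u] that ik by (metis injD)
      qed
    qed (use that in auto)
    have inverted: "inv w (Suc k) < inv w k" using i pre ik by (simp add: g_def)
    with bad have "together_in_321 n w k (Suc k)" by simp
    then obtain p q r where pqr: "1 \<le> p" "p < q" "q < r" "r \<le> n" "w p > w q" "w q > w r"
      "k \<in> {w p, w q, w r}" "Suc k \<in> {w p, w q, w r}"
      by (auto simp: together_in_321_def)
    have pos: "inv w (w x) = x" for x by (simp add: permutes_inverses(2)[OF w])
    have uinv: "u (inv u x) = x" for x by (simp add: permutes_inverses(1)[OF u])
    \<comment> \<open>No value lies strictly between \<open>k\<close> and \<open>k + 1\<close>, so
      they are neighbours in the pattern.\<close>
    have "(w q = Suc k \<and> w r = k) \<or> (w p = Suc k \<and> w q = k)"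
      using pqr by auto
    then show False
    proof
      assume c: "w q = Suc k \<and> w r = k"
      define j where "j = inv u (w p)"
      have uj: "u j = w p" by (simp add: j_def uinv)
      have "w p \<in> {1..n}" using permutes_in_image[OF w, of p] pqr by auto
      then have jn: "j \<in> {1..n}" unfolding j_def by (rule inv_in_interval[OF u])
      have "j > Suc k"
      proof (rule ccontr)
        assume "\<not> j > Suc k"
        then consider "j = Suc k" | "j = k" | "j \<in> {1..<i}" using jn ik by force
        then show False
        proof cases
          case 3
          then have "u j \<in> {1..<k}" using pre(3) by blast
          then show False using uj c pqr by simp
        qed (use uj pre ik c pqr in auto)
      qed
      then have "g (Suc k) < g j"
        using increasing_interval[of "Suc k" n g "Suc k" j] other jn by auto
      then have "inv w (Suc k) < inv w (w p)" using pre ik uj by (simp add: g_def)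
      then show False using c pos[of p] pos[of q] pqr by simp
    next
      assume c: "w p = Suc k \<and> w q = k"
      have "w r \<in> {1..n}" using permutes_in_image[OF w, of r] pqr by auto
      then have "w r \<in> u ` {1..<i}" using pre(3) c pqr by auto
      then obtain j where j: "1 \<le> j" "j < k" "u j = w r" using ik by auto
      then have "g j < g k"
        using increasing_interval[of 1 k g j k] other k by auto
      then have "inv w (w r) < inv w k" using pre ik j by (simp add: g_def)
      then show False using c pos[of r] pos[of q] pqr by simp
    qed
  qed
qed

section \<open>Left-to-right maxima, right-to-left minima and 321-patterns\<close>

lemma left_to_right_maximum_alt:
  assumes w: "w permutes {1..n}" and x: "x \<in> {1..n}"
  shows "left_to_right_maximum n w x \<longleftrightarrow> (\<forall>c\<in>{1..n}. inv w c < inv w x \<longrightarrow> c < x)"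
proof
  assume "left_to_right_maximum n w x"
  then obtain i where i: "i \<in> {1..n}" "x = w i" "\<forall>j\<in>{1..n}. j < i \<longrightarrow> w j < w i"
    by (auto simp: left_to_right_maximum_def)
  show "\<forall>c\<in>{1..n}. inv w c < inv w x \<longrightarrow> c < x"
    using i inv_in_interval[OF w] permutes_inverses[OF w] by metis
next
  assume R: "\<forall>c\<in>{1..n}. inv w c < inv w x \<longrightarrow> c < x"
  have "w j < x" if "j \<in> {1..n}" "j < inv w x" for j
    using R[rule_format, of "w j"] that permutes_in_image[OF w, of j] permutes_inverses(2)[OF w, of j]
    by simp
  then show "left_to_right_maximum n w x"
    unfolding left_to_right_maximum_def
    using inv_in_interval[OF w x] permutes_inverses(1)[OF w]
    by (intro bexI[of _ "inv w x"]) auto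
qed

lemma right_to_left_minimum_alt:
  assumes w: "w permutes {1..n}" and x: "x \<in> {1..n}"
  shows "right_to_left_minimum n w x \<longleftrightarrow> (\<forall>c\<in>{1..n}. inv w x < inv w c \<longrightarrow> x < c)"
proof
  assume "right_to_left_minimum n w x"
  then obtain i where i: "i \<in> {1..n}" "x = w i" "\<forall>j\<in>{1..n}. i < j \<longrightarrow> w i < w j"
    by (auto simp: right_to_left_minimum_def)
  show "\<forall>c\<in>{1..n}. inv w x < inv w c \<longrightarrow> x < c"
    using i inv_in_interval[OF w] permutes_inverses[OF w] by metis
next
  assume R: "\<forall>c\<in>{1..n}. inv w x < inv w c \<longrightarrow> x < c"
  have "x < w j" if "j \<in> {1..n}" "inv w x < j" for j
    using R[rule_format, of "w j"] that permutes_in_image[OF w, of j] permutes_inverses(2)[OF w, of j]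
    by simp
  then show "right_to_left_minimum n w x"
    unfolding right_to_left_minimum_def
    using inv_in_interval[OF w x] permutes_inverses(1)[OF w]
    by (intro bexI[of _ "inv w x"]) auto
qed

text \<open>If \<open>k\<close> came first, the values up to its position would be exactly
  \<open>{1..k}\<close>: all later values exceed \<open>k\<close>, and all values before
  \<open>k + 1\<close> are at most \<open>k\<close>. Full support forbids this.\<close>

lemma maximum_minimum_inverted:
  assumes w: "w permutes {1..n}" and fs: "fully_supported n w" and k: "1 \<le> k" "k < n"
    and mx: "left_to_right_maximum n w (Suc k)" and mn: "right_to_left_minimum n w k"
  shows "inv w (Suc k) < inv w k"
proof (rule ccontr)
  assume neg: "\<not> ?thesis"
  have winv: "w (inv w x) = x" "inv w (w x) = x" for x by (simp_all add: permutes_inverses[OF w])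
  have "inv w (Suc k) \<noteq> inv w k" using winv by (metis n_not_Suc_n)
  then have lt: "inv w k < inv w (Suc k)" using neg by simp
  have mx': "c < Suc k" if "c \<in> {1..n}" "inv w c < inv w (Suc k)" for c
    using mx left_to_right_maximum_alt[OF w, of "Suc k"] that k by simp
  have mn': "k < c" if "c \<in> {1..n}" "inv w k < inv w c" for c
    using mn right_to_left_minimum_alt[OF w, of k] that k by simp
  define r where "r = inv w k"
  have r: "1 \<le> r" "r \<le> n" using inv_in_interval[OF w, of k] k by (auto simp: r_def)
  have sub: "{1..k} \<subseteq> w ` {1..r}"
  proof
    fix c assume c: "c \<in> {1..k}"
    then have cn: "c \<in> {1..n}" using k by simp
    have "\<not> r < inv w c" using mn'[OF cn] c by (auto simp: r_def)
    then have "inv w c \<in> {1..r}" using inv_in_interval[OF w cn] by simp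
    then show "c \<in> w ` {1..r}" using winv by (metis imageI)
  qed
  have sup: "w ` {1..r} \<subseteq> {1..k}"
  proof
    fix c assume "c \<in> w ` {1..r}"
    then obtain j where j: "j \<in> {1..r}" "c = w j" by auto
    then have "c \<in> {1..n}" using permutes_in_image[OF w, of j] r by auto
    moreover have "inv w c < inv w (Suc k)" using j lt winv by (simp add: r_def)
    ultimately show "c \<in> {1..k}" using mx'[of c] by auto
  qed
  have eq: "w ` {1..r} = {1..k}" using sub sup by blast
  have "card (w ` {1..r}) = r"
    using card_image[of w "{1..r}"] permutes_inj[OF w] by (metis card_atLeastAtMost diff_Suc_1 inj_on_subset subset_UNIV)
  then have "r = k" using eq by simp
  then show False using eq fs k by (auto simp: fully_supported_def)
qed

text \<open>With \<open>k + 1\<close> before \<open>k\<close>, a larger value before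
  \<open>k + 1\<close> or a smaller one after \<open>k\<close> completes a 321-pattern, and there is
  no other kind through both values. In the converse the inversion itself comes from full
  support.\<close>

lemma inverted_avoiding_321_iff:
  assumes w: "w permutes {1..n}" and fs: "fully_supported n w" and k: "1 \<le> k" "k < n"
  shows "inv w (Suc k) < inv w k \<and> \<not> together_in_321 n w k (Suc k) \<longleftrightarrow>
    left_to_right_maximum n w (Suc k) \<and> right_to_left_minimum n w k" (is "?L \<longleftrightarrow> ?R")
proof
  have winv: "w (inv w x) = x" "inv w (w x) = x" for x by (simp_all add: permutes_inverses[OF w])
  have alt: "left_to_right_maximum n w (Suc k) \<longleftrightarrow> (\<forall>c\<in>{1..n}. inv w c < inv w (Suc k) \<longrightarrow> c < Suc k)"
    "right_to_left_minimum n w k \<longleftrightarrow> (\<forall>c\<in>{1..n}. inv w k < inv w c \<longrightarrow> k < c)"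
    using left_to_right_maximum_alt[OF w, of "Suc k"] right_to_left_minimum_alt[OF w, of k] k by auto
  have inj: "inv w x = inv w y \<Longrightarrow> x = y" for x y using winv by metis
  {
    assume L: ?L
    have "c < Suc k" if "c \<in> {1..n}" "inv w c < inv w (Suc k)" for c
    proof (rule ccontr)
      assume "\<not> c < Suc k"
      then have "c > Suc k" using that by (cases "c = Suc k") auto
      then have "together_in_321 n w k (Suc k)"
        unfolding together_in_321_def using that L k inv_in_interval[OF w] winv
        by (intro exI[of _ "inv w c"] exI[of _ "inv w (Suc k)"] exI[of _ "inv w k"]) auto
      then show False using L by simp
    qed
    moreover have "k < c" if "c \<in> {1..n}" "inv w k < inv w c" for c
    proof (rule ccontr)
      assume "\<not> k < c"
      then have "c < k" using that by (cases "c = k") auto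
      then have "together_in_321 n w k (Suc k)"
        unfolding together_in_321_def using that L k inv_in_interval[OF w] winv
        by (intro exI[of _ "inv w (Suc k)"] exI[of _ "inv w k"] exI[of _ "inv w c"]) auto
      then show False using L by simp
    qed
    ultimately show ?R using alt by blast
  }
  {
    assume R: ?R
    have "inv w (Suc k) < inv w k" using maximum_minimum_inverted[OF w fs k] R by simp
    moreover have "\<not> together_in_321 n w k (Suc k)"
    proof
      assume "together_in_321 n w k (Suc k)"
      then obtain p q r where pqr: "1 \<le> p" "p < q" "q < r" "r \<le> n" "w p > w q" "w q > w r"
        "k \<in> {w p, w q, w r}" "Suc k \<in> {w p, w q, w r}"
        by (auto simp: together_in_321_def)
      have wn: "w p \<in> {1..n}" "w r \<in> {1..n}"
        using permutes_in_image[OF w, of p] permutes_in_image[OF w, of r] pqr by auto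
      have "(w q = Suc k \<and> w r = k) \<or> (w p = Suc k \<and> w q = k)"
        using pqr by auto
      then show False
      proof
        assume "w q = Suc k \<and> w r = k"
        then show False using R alt wn winv(2)[of p] winv(2)[of q] pqr
          by (metis less_asym)
      next
        assume "w p = Suc k \<and> w q = k"
        then show False using R alt wn winv(2)[of r] winv(2)[of q] pqr
          by (metis less_asym)
      qed
    qed
    ultimately show ?L by simp
  }
qed

subsection \<open>Paths as functions of the depth\<close>

text \<open>Think of \<open>\<delta>\<close> as mass moved between weights, gained only above where
  it is lost. Since gains and losses cancel, all weights may be shifted by a constant; with a
  constant between the losing and the gaining weights every term is nonnegative.\<close>

lemma weighted_sum_nonneg:
  fixes \<delta> s :: "'a \<Rightarrow> real"
  assumes fin: "finite A"
    and ord: "\<And>l m. l \<in> A \<Longrightarrow> m \<in> A \<Longrightarrow> 0 < \<delta> l \<Longrightarrow> \<delta> m < 0 \<Longrightarrow> s m < s l"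
    and zero: "(\<Sum>l\<in>A. \<delta> l) = 0"
  shows "0 \<le> (\<Sum>l\<in>A. s l * \<delta> l)"
    and "(\<Sum>l\<in>A. s l * \<delta> l) = 0 \<Longrightarrow> l \<in> A \<Longrightarrow> \<delta> l = 0"
proof -
  define N where "N = {m \<in> A. \<delta> m < 0}"
  have "0 \<le> (\<Sum>l\<in>A. s l * \<delta> l) \<and> ((\<Sum>l\<in>A. s l * \<delta> l) = 0 \<longrightarrow> (\<forall>l\<in>A. \<delta> l = 0))"
  proof (cases "N = {}")
    case True
    then have "0 \<le> \<delta> l" if "l \<in> A" for l using that by (force simp: N_def)
    then have "\<forall>l\<in>A. \<delta> l = 0"
      using zero sum_nonneg_eq_0_iff[OF fin, of \<delta>] by blast
    then show ?thesis by simp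
  next
    case False
    have finN: "finite N" using fin by (simp add: N_def)
    \<comment> \<open>The largest losing weight; every gaining weight is strictly above it, which
      settles the case of equality.\<close>
    define \<sigma> where "\<sigma> = Max (s ` N)"
    have neg: "s m \<le> \<sigma>" if "m \<in> N" for m using that finN by (simp add: \<sigma>_def)
    have pos: "\<sigma> < s l" if "l \<in> A" "0 < \<delta> l" for l
      using ord[OF that(1)] that finN False by (auto simp: \<sigma>_def N_def)
    have shift: "(\<Sum>l\<in>A. s l * \<delta> l) = (\<Sum>l\<in>A. (s l - \<sigma>) * \<delta> l)"
      unfolding left_diff_distrib sum_subtractf sum_distrib_left[symmetric] using zero by simp
    have nn: "0 \<le> (s l - \<sigma>) * \<delta> l" if "l \<in> A" for l
    proof (cases "\<delta> l" "0::real" rule: linorder_cases)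
      case less
      then have "s l \<le> \<sigma>" using neg[of l] that by (simp add: N_def)
      then show ?thesis using less by (intro mult_nonpos_nonpos) auto
    next
      case greater
      then show ?thesis using pos[OF that] by simp
    qed simp
    have "\<delta> l = 0" if eq: "(\<Sum>l\<in>A. (s l - \<sigma>) * \<delta> l) = 0" and l: "l \<in> A" for l
    proof -
      have terms: "(s l - \<sigma>) * \<delta> l = 0" if "l \<in> A" for l
        using eq sum_nonneg_eq_0_iff[OF fin nn] that by simp
      have "\<delta> l \<le> 0" if "l \<in> A" for l
      proof (rule ccontr)
        assume "\<not> \<delta> l \<le> 0"
        then show False using terms[OF that] pos[OF that] by simp
      qed
      then show ?thesis
        using zero sum_nonneg_eq_0_iff[OF fin, of "\<lambda>l. - \<delta> l"] l by (simp add: sum_negf)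
    qed
    then show ?thesis using sum_nonneg[OF nn] shift by auto
  qed
  then show "0 \<le> (\<Sum>l\<in>A. s l * \<delta> l)"
    and "(\<Sum>l\<in>A. s l * \<delta> l) = 0 \<Longrightarrow> l \<in> A \<Longrightarrow> \<delta> l = 0" by blast+
qed

locale angles =
  fixes n :: nat and \<theta> :: "nat \<Rightarrow> real"
  assumes admissible: "admissible_angles n \<theta>"
begin

definition height :: "nat \<Rightarrow> real" where
  "height l = - sin (\<theta> l)"

text \<open>Horizontal displacement per unit of depth, that is, \<open>- cot (\<theta> l)\<close>;
  it orders the downward directions from left to right.\<close>

definition slope :: "nat \<Rightarrow> real" where
  "slope l = cos (\<theta> l) / height l"

definition depth :: "complex \<Rightarrow> real" where
  "depth z = - Im z"

definition total :: real where
  "total = (\<Sum>l\<in>{1..n}. height l)"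

definition level :: "(nat \<Rightarrow> nat) \<Rightarrow> nat \<Rightarrow> real" where
  "level u k = (\<Sum>i=1..k. height (u i))"

text \<open>The part of the edge labeled \<open>l\<close> that lies above depth \<open>y\<close>.
  The edge starts at the vertex with index \<open>inv u l - 1\<close>; clipping to
  \<open>[0, height l]\<close> takes care of edges not yet begun and of finished ones.\<close>

definition share :: "(nat \<Rightarrow> nat) \<Rightarrow> nat \<Rightarrow> real \<Rightarrow> real" where
  "share u l y = max 0 (min (height l) (y - level u (inv u l - 1)))"

text \<open>Abscissa of the path at depth \<open>y\<close>. Summing over labels instead of edges
  gives two paths the same index set and the same coefficients, so that they can be compared term by
  term.\<close>

definition path_x :: "(nat \<Rightarrow> nat) \<Rightarrow> real \<Rightarrow> real" where
  "path_x u y = (\<Sum>l\<in>{1..n}. slope l * share u l y)"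

abbreviation vertex :: "(nat \<Rightarrow> nat) \<Rightarrow> nat \<Rightarrow> complex" where
  "vertex u k \<equiv> path_vertex \<theta> u k"

lemma height_pos: "l \<in> {1..n} \<Longrightarrow> 0 < height l"
  using admissible sin_lt_zero[of "\<theta> l"] by (simp add: admissible_angles_def height_def)

text \<open>Cross-multiplied, the difference of the slopes is
  \<open>sin (\<theta> b - \<theta> a)\<close>, positive because both angles lie in an open interval
  of length \<open>pi\<close>.\<close>

lemma slope_less:
  assumes "a \<in> {1..n}" "b \<in> {1..n}" "a < b"
  shows "slope a < slope b"
proof -
  have "\<theta> a < \<theta> b" "\<theta> b < 2 * pi" "pi < \<theta> a"
    using admissible assms by (auto simp: admissible_angles_def strict_mono_on_def)
  then have "0 < sin (\<theta> b - \<theta> a)" by (intro sin_gt_zero) auto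
  then have "cos (\<theta> a) * height b < cos (\<theta> b) * height a"
    by (simp add: sin_diff height_def algebra_simps)
  then show ?thesis
    using height_pos assms by (simp add: slope_def field_simps)
qed

lemma slope_less_iff:
  "a \<in> {1..n} \<Longrightarrow> b \<in> {1..n} \<Longrightarrow> slope a < slope b \<longleftrightarrow> a < b"
  using slope_less by (metis less_asym linorder_neqE_nat)

lemma slope_le_iff:
  "a \<in> {1..n} \<Longrightarrow> b \<in> {1..n} \<Longrightarrow> slope a \<le> slope b \<longleftrightarrow> a \<le> b"
  using slope_less_iff[of b a] by (simp add: not_less[symmetric])

lemma depth_simps [simp]:
  "depth (z + z') = depth z + depth z'" "depth (z - z') = depth z - depth z'"
  "depth (cis (\<theta> l)) = height l" "depth (of_real r) = 0"
  "depth (r *\<^sub>R z) = r * depth z" "depth (Complex x y) = - y" "depth 0 = 0"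
  by (simp_all add: depth_def height_def)

lemma complex_eq_depth: "z = z' \<longleftrightarrow> Re z = Re z' \<and> depth z = depth z'"
  by (auto simp: depth_def complex_eq_iff)

lemma Re_cis_slope: "l \<in> {1..n} \<Longrightarrow> Re (cis (\<theta> l)) = slope l * height l"
  using height_pos[of l] by (simp add: slope_def)

lemma vertex_0 [simp]: "vertex u 0 = 0"
  by (simp add: path_vertex_def)

lemma vertex_Suc: "vertex u (Suc k) = vertex u k + cis (\<theta> (u (Suc k)))"
  by (simp add: path_vertex_def)

lemma level_0 [simp]: "level u 0 = 0"
  by (simp add: level_def)

lemma level_Suc: "level u (Suc k) = level u k + height (u (Suc k))"
  by (simp add: level_def)

lemma depth_vertex [simp]: "depth (vertex u k) = level u k"
  by (induction k) (simp_all add: vertex_Suc level_Suc)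

lemma permutes_label: "u permutes {1..n} \<Longrightarrow> i < n \<Longrightarrow> u (Suc i) \<in> {1..n}"
  using permutes_in_image[of u "{1..n}" "Suc i"] by auto

lemma level_less:
  assumes u: "u permutes {1..n}" and "i < j" "j \<le> n"
  shows "level u i < level u j"
  using assms(2,3)
proof (induction j)
  case (Suc j)
  then show ?case
    using height_pos[OF permutes_label[OF u, of j]] by (cases "i = j") (auto simp: level_Suc)
qed simp

lemma level_mono:
  assumes u: "u permutes {1..n}" and "i \<le> j" "j \<le> n"
  shows "level u i \<le> level u j"
  using level_less[OF u, of i j] assms by (cases "i = j") auto

lemma level_n: "u permutes {1..n} \<Longrightarrow> level u n = total"
  using sum.permute[of u "{1..n}" height] by (simp add: level_def total_def)

lemma share_nonneg: "0 \<le> share u l y"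
  by (simp add: share_def)

lemma share_le: "l \<in> {1..n} \<Longrightarrow> share u l y \<le> height l"
  using height_pos[of l] by (simp add: share_def)

lemma share_at:
  assumes u: "u permutes {1..n}" and i: "i < n" and y: "level u i \<le> y" "y \<le> level u (Suc i)"
  shows "j < i \<Longrightarrow> share u (u (Suc j)) y = height (u (Suc j))"
    and "share u (u (Suc i)) y = y - level u i"
    and "i < j \<Longrightarrow> j < n \<Longrightarrow> share u (u (Suc j)) y = 0"
proof -
  have inv: "inv u (u (Suc j)) = Suc j" for j by (simp add: permutes_inverses(2)[OF u])
  have pos: "j < n \<Longrightarrow> 0 < height (u (Suc j))" for j using height_pos permutes_label[OF u] by blast
  show "share u (u (Suc j)) y = height (u (Suc j))" if "j < i"
    using level_mono[OF u, of "Suc j" i] that i y pos[of j] by (simp add: share_def inv level_Suc)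
  show "share u (u (Suc i)) y = y - level u i"
    using i y by (simp add: share_def inv level_Suc)
  show "share u (u (Suc j)) y = 0" if "i < j" "j < n"
    using level_mono[OF u, of "Suc i" j] that i y pos[of j] by (simp add: share_def inv)
qed

lemma sum_labels:
  assumes u: "u permutes {1..n}"
  shows "(\<Sum>l\<in>{1..n}. g l) = (\<Sum>j<n. g (u (Suc j)))"
  using sum.permute[OF u, of g] by (simp add: sum.atLeast1_atMost_eq)

lemma split_lessThan: "i < n \<Longrightarrow> {..<n} = {..<i} \<union> {i} \<union> {Suc i..<n}" for i :: nat
  by auto

lemma sum_share_at:
  assumes u: "u permutes {1..n}" and i: "i < n" and y: "level u i \<le> y" "y \<le> level u (Suc i)"
  shows "(\<Sum>l\<in>{1..n}. g l * share u l y) =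
    (\<Sum>j<i. g (u (Suc j)) * height (u (Suc j))) + g (u (Suc i)) * (y - level u i)"
proof -
  have "(\<Sum>l\<in>{1..n}. g l * share u l y) = (\<Sum>j<n. g (u (Suc j)) * share u (u (Suc j)) y)"
    by (rule sum_labels[OF u])
  also have "\<dots> = (\<Sum>j<i. g (u (Suc j)) * share u (u (Suc j)) y)
      + g (u (Suc i)) * share u (u (Suc i)) y + (\<Sum>j\<in>{Suc i..<n}. g (u (Suc j)) * share u (u (Suc j)) y)"
    unfolding split_lessThan[OF i]
    by (subst sum.union_disjoint, simp, simp, force, subst sum.union_disjoint) auto
  also have "(\<Sum>j\<in>{Suc i..<n}. g (u (Suc j)) * share u (u (Suc j)) y) = 0"
    using share_at(3)[OF u i y] by (intro sum.neutral) auto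
  also have "(\<Sum>j<i. g (u (Suc j)) * share u (u (Suc j)) y) = (\<Sum>j<i. g (u (Suc j)) * height (u (Suc j)))"
    using share_at(1)[OF u i y] by (intro sum.cong) auto
  finally show ?thesis using share_at(2)[OF u i y] by simp
qed

lemma level_alt: "level u i = (\<Sum>j<i. height (u (Suc j)))"
  by (simp add: level_def sum.atLeast1_atMost_eq)

lemma sum_share:
  assumes u: "u permutes {1..n}" and i: "i < n" and y: "level u i \<le> y" "y \<le> level u (Suc i)"
  shows "(\<Sum>l\<in>{1..n}. share u l y) = y"
  using sum_share_at[OF assms, of "\<lambda>_. 1"] by (simp add: level_alt)

text \<open>Ties the sum over labels to the geometric path: the finished edges add up to the last
  vertex passed, and the current edge contributes its slope for the remaining depth.\<close>

lemma path_x_at: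
  assumes u: "u permutes {1..n}" and i: "i < n" and y: "level u i \<le> y" "y \<le> level u (Suc i)"
  shows "path_x u y = Re (vertex u i) + slope (u (Suc i)) * (y - level u i)"
proof -
  have "k \<le> n \<Longrightarrow> (\<Sum>j<k. slope (u (Suc j)) * height (u (Suc j))) = Re (vertex u k)" for k
    by (induction k) (auto simp: vertex_Suc Re_cis_slope[OF permutes_label[OF u]] simp del: cis.sel)
  then show ?thesis using sum_share_at[OF assms, of slope] i by (simp add: path_x_def)
qed

lemma path_x_vertex:
  assumes u: "u permutes {1..n}" and i: "i \<le> n" and n: "0 < n"
  shows "path_x u (level u i) = Re (vertex u i)"
proof (cases "i < n")
  case True
  then show ?thesis using path_x_at[OF u True] level_mono[OF u, of i "Suc i"] by simp
next
  case False
  then obtain j where j: "n = Suc j" "i = Suc j" using i n by (cases n) auto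
  then show ?thesis
    using path_x_at[OF u, of j "level u i"] level_mono[OF u, of j "Suc j"] Re_cis_slope[OF permutes_label[OF u, of j]]
    by (simp add: vertex_Suc level_Suc)
qed

text \<open>Half-open, so that at the depth of a vertex the edge below it is taken; this leaves out
  only the bottom.\<close>

lemma exists_edge:
  assumes u: "u permutes {1..n}" and y: "0 \<le> y" "y < total"
  obtains i where "i < n" "level u i \<le> y" "y < level u (Suc i)"
proof -
  define i where "i = (LEAST i. y < level u i)"
  have ex: "y < level u n" using level_n[OF u] y by simp
  have lt: "y < level u i" unfolding i_def by (rule LeastI[of "\<lambda>i. y < level u i", OF ex])
  have "i \<le> n" unfolding i_def by (rule Least_le[of "\<lambda>i. y < level u i", OF ex])
  have "i \<noteq> 0" using lt y by (metis level_0 not_less)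
  then obtain j where j: "i = Suc j" by (cases i) auto
  then have "\<not> y < level u j" using not_less_Least[of j "\<lambda>i. y < level u i"] by (simp add: i_def)
  then show ?thesis using that[of j] lt j \<open>i \<le> n\<close> by simp
qed

lemma exists_edge_closed:
  assumes u: "u permutes {1..n}" and y: "0 \<le> y" "y \<le> total" and n: "0 < n"
  obtains i where "i < n" "level u i \<le> y" "y \<le> level u (Suc i)"
proof (cases "y = total")
  case True
  obtain j where j: "n = Suc j" using n by (cases n) auto
  then show ?thesis
    using that[of j] level_n[OF u] True level_mono[OF u, of j n] by simp
next
  case False
  then show ?thesis using exists_edge[OF u, of y] y that by (metis less_le)
qed

lemma sum_share_total:
  assumes u: "u permutes {1..n}" and y: "0 \<le> y" "y \<le> total" and n: "0 < n"
  shows "(\<Sum>l\<in>{1..n}. share u l y) = y"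
  using exists_edge_closed[OF assms] sum_share[OF u] by metis

lemma continuous_path_x: "continuous_on UNIV (path_x u)"
  unfolding path_x_def share_def by (intro continuous_intros)

text \<open>The edge of \<open>m\<close> begins above depth \<open>y\<close> and that of
  \<open>l\<close> ends below it, while the levels increase along the path.\<close>

lemma share_order:
  assumes u: "u permutes {1..n}" and lm: "l \<in> {1..n}" "m \<in> {1..n}" "l \<noteq> m"
    and "share u l y < height l" "0 < share u m y"
  shows "inv u m < inv u l"
proof -
  have lev: "level u (inv u l - 1) + height l = level u (inv u l)" if l: "l \<in> {1..n}" for l
  proof -
    obtain j where "inv u l = Suc j" using inv_in_interval[OF u l] by (cases "inv u l") auto
    moreover from this have "u (Suc j) = l" using permutes_inverses(1)[OF u] by metis
    ultimately show ?thesis by (simp add: level_Suc)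
  qed
  have "level u (inv u m - 1) < y" "y < level u (inv u l)"
    using assms(5,6) lev[OF lm(1)] height_pos[OF lm(1)]
    by (auto simp: share_def max_def min_def split: if_splits)
  then have lt: "level u (inv u m - 1) < level u (inv u l)" by simp
  have "inv u m - 1 < inv u l"
  proof (rule ccontr)
    assume "\<not> ?thesis"
    moreover have "inv u m - 1 \<le> n" using inv_in_interval[OF u lm(2)] by auto
    ultimately show False using level_mono[OF u, of "inv u l" "inv u m - 1"] lt by simp
  qed
  moreover have "inv u m \<noteq> inv u l" using lm(3) permutes_inverses(1)[OF u] by metis
  moreover have "1 \<le> inv u m" using inv_in_interval[OF u lm(2)] by simp
  ultimately show ?thesis by linarith
qed

text \<open>By \<open>share_order\<close>, if \<open>m\<close> loses and \<open>l\<close> gains,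
  then \<open>m\<close> stands before \<open>l\<close> in \<open>u\<close> and after it in
  \<open>v\<close>. With \<open>l < m\<close> this would be an inversion of \<open>u\<close> missing
  in \<open>v\<close>; hence every gaining label has a larger slope than every losing one.\<close>

lemma path_x_weak_le:
  assumes u: "u permutes {1..n}" and v: "v permutes {1..n}" and uv: "weak_le n u v"
    and y: "0 \<le> y" "y \<le> total" and n: "0 < n"
  shows "path_x u y \<le> path_x v y"
    and "path_x u y = path_x v y \<Longrightarrow> l \<in> {1..n} \<Longrightarrow> share u l y = share v l y"
proof -
  define \<delta> where "\<delta> l = share v l y - share u l y" for l
  have ord: "slope m < slope l" if "l \<in> {1..n}" "m \<in> {1..n}" "0 < \<delta> l" "\<delta> m < 0" for l m
  proof -
    have less: "share u l y < share v l y" "share v m y < share u m y" using that by (auto simp: \<delta>_def)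
    have "l \<noteq> m" using less by auto
    have "inv u m < inv u l"
      using share_order[OF u that(1,2) \<open>l \<noteq> m\<close>, of y] less share_le[OF that(1), of v y] share_nonneg[of v m y]
      by linarith
    moreover have "inv v l < inv v m"
      using share_order[OF v that(2,1) \<open>l \<noteq> m\<close>[symmetric], of y] less share_le[OF that(2), of u y] share_nonneg[of u l y]
      by linarith
    ultimately have "\<not> l < m" using weak_leD[OF uv that(1,2)] by auto
    then show ?thesis using slope_less[OF that(2,1)] \<open>l \<noteq> m\<close> by simp
  qed
  have zero: "(\<Sum>l\<in>{1..n}. \<delta> l) = 0"
    using sum_share_total[OF u y n] sum_share_total[OF v y n] by (simp add: \<delta>_def sum_subtractf)
  have diff: "path_x v y - path_x u y = (\<Sum>l\<in>{1..n}. slope l * \<delta> l)"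
    by (simp add: path_x_def \<delta>_def right_diff_distrib sum_subtractf)
  have fin: "finite {1..n}" by simp
  have ws: "0 \<le> (\<Sum>l\<in>{1..n}. slope l * \<delta> l)"
    "(\<Sum>l\<in>{1..n}. slope l * \<delta> l) = 0 \<Longrightarrow> l \<in> {1..n} \<Longrightarrow> \<delta> l = 0" for l
    using weighted_sum_nonneg[of "{1..n}" \<delta> slope, OF fin] ord zero by blast+
  show "path_x u y \<le> path_x v y" using ws(1) diff by simp
  show "path_x u y = path_x v y \<Longrightarrow> l \<in> {1..n} \<Longrightarrow> share u l y = share v l y"
    using ws(2) diff by (simp add: \<delta>_def)
qed

lemma full_labels:
  assumes u: "u permutes {1..n}" and i: "i < n" and y: "level u i \<le> y" "y < level u (Suc i)"
  shows "{l \<in> {1..n}. share u l y = height l} = u ` {1..i}"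
    and "level u i < y \<Longrightarrow> {l \<in> {1..n}. 0 < share u l y} = u ` {1..Suc i}"
proof -
  have lab: "l \<in> {1..n} \<longleftrightarrow> (\<exists>j<n. l = u (Suc j))" for l
  proof
    assume l: "l \<in> {1..n}"
    then have "l = u (inv u l)" "inv u l \<in> {1..n}"
      using permutes_inverses(1)[OF u] inv_in_interval[OF u] by auto
    then show "\<exists>j<n. l = u (Suc j)" by (intro exI[of _ "inv u l - 1"]) auto
  qed (use permutes_label[OF u] in auto)
  have inj: "u a = u b \<longleftrightarrow> a = b" for a b by (rule inj_eq[OF permutes_inj[OF u]])
  have im: "u (Suc j) \<in> u ` {1..m} \<longleftrightarrow> j < m" for j m
    by (auto simp: inj)
  note sh = share_at[OF u i y(1) less_imp_le[OF y(2)]]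
  have ht: "0 < height (u (Suc j))" if "j < n" for j
    using height_pos[OF permutes_label[OF u that]] .
  have full: "share u (u (Suc j)) y = height (u (Suc j)) \<longleftrightarrow> j < i" if "j < n" for j
  proof (cases j i rule: linorder_cases)
    case less then show ?thesis using sh(1) by simp
  next
    case equal
    then have "share u (u (Suc j)) y \<noteq> height (u (Suc j))" using sh(2) y by (simp add: level_Suc)
    then show ?thesis using equal by simp
  next
    case greater
    then show ?thesis using sh(3)[of j] that ht[OF that] by simp
  qed
  have pos: "0 < share u (u (Suc j)) y \<longleftrightarrow> j < Suc i" if "j < n" "level u i < y" for j
  proof (cases j i rule: linorder_cases)
    case less then show ?thesis using sh(1) ht[OF that(1)] by simp
  next
    case equal then show ?thesis using sh(2) that by simp
  next
    case greater
    then show ?thesis using sh(3)[of j] that by simp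
  qed
  have sub: "u ` {1..m} \<subseteq> {1..n}" if "m \<le> n" for m
    using image_mono[of "{1..m}" "{1..n}" u] that unfolding permutes_image[OF u] by simp
  show "{l \<in> {1..n}. share u l y = height l} = u ` {1..i}"
  proof (intro set_eqI iffI)
    fix l assume "l \<in> {l \<in> {1..n}. share u l y = height l}"
    then obtain j where "j < n" "l = u (Suc j)" "share u l y = height l" using lab[of l] by blast
    then show "l \<in> u ` {1..i}" using full im by simp
  next
    fix l assume l: "l \<in> u ` {1..i}"
    then have "l \<in> {1..n}" using sub[of i] i by auto
    moreover from this obtain j where "j < n" "l = u (Suc j)" using lab[of l] by blast
    ultimately show "l \<in> {l \<in> {1..n}. share u l y = height l}" using full im l by simp
  qed
  show "{l \<in> {1..n}. 0 < share u l y} = u ` {1..Suc i}" if "level u i < y"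
  proof (intro set_eqI iffI)
    fix l assume "l \<in> {l \<in> {1..n}. 0 < share u l y}"
    then obtain j where "j < n" "l = u (Suc j)" "0 < share u l y" using lab[of l] by blast
    then show "l \<in> u ` {1..Suc i}" using pos[of j] that im[of j "Suc i"] by simp
  next
    fix l assume l: "l \<in> u ` {1..Suc i}"
    then have "l \<in> {1..n}" using sub[of "Suc i"] i by auto
    moreover from this obtain j where j: "j < n" "l = u (Suc j)" using lab[of l] by blast
    moreover have "j < Suc i" using l im[of j "Suc i"] j(2) by simp
    ultimately show "l \<in> {l \<in> {1..n}. 0 < share u l y}" using pos[of j] that by simp
  qed
qed

text \<open>Equal shares give the same set of finished labels, so both paths have used the same
  vectors, perhaps in a different order, and arrive at the same vertex. Strictly below it the sets
  of begun labels agree too, and their one extra element is the label of the current edge.\<close>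

lemma common_prefix:
  assumes u: "u permutes {1..n}" and v: "v permutes {1..n}"
    and eq: "\<forall>l\<in>{1..n}. share u l y = share v l y"
    and i: "i < n" and y: "level u i \<le> y" "y < level u (Suc i)"
  shows "v ` {1..i} = u ` {1..i}" and "level v i = level u i" and "vertex v i = vertex u i"
    and "level u i < y \<Longrightarrow> v (Suc i) = u (Suc i)"
    and "y < level v (Suc i)"
proof -
  have inju: "inj_on u S" and injv: "inj_on v S" for S
    using permutes_inj[OF u] permutes_inj[OF v] by (auto intro: inj_on_subset)
  have "y < total" using level_mono[OF u, of "Suc i" n] i y level_n[OF u] by simp
  moreover have "0 \<le> y" using level_mono[OF u, of 0 i] i y by simp
  ultimately obtain j where j: "j < n" "level v j \<le> y" "y < level v (Suc j)"
    using exists_edge[OF v] by blast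
  have "{l \<in> {1..n}. share u l y = height l} = {l \<in> {1..n}. share v l y = height l}"
    using eq by auto
  then have im: "u ` {1..i} = v ` {1..j}"
    using full_labels(1)[OF u i y] full_labels(1)[OF v j] by simp
  then have "card (u ` {1..i}) = card (v ` {1..j})" by simp
  then have ij: "i = j" using card_image[OF inju] card_image[OF injv] by simp
  show pre: "v ` {1..i} = u ` {1..i}" using im ij by simp
  have "sum g (v ` {1..i}) = (\<Sum>j=1..i. g (v j))" "sum g (u ` {1..i}) = (\<Sum>j=1..i. g (u j))" for g :: "nat \<Rightarrow> real"
    using sum.reindex[OF inju] sum.reindex[OF injv] by simp_all
  then show lev: "level v i = level u i" unfolding level_def using pre by metis
  have "sum g (v ` {1..i}) = (\<Sum>j=1..i. g (v j))" "sum g (u ` {1..i}) = (\<Sum>j=1..i. g (u j))" for g :: "nat \<Rightarrow> complex"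
    using sum.reindex[OF inju] sum.reindex[OF injv] by simp_all
  from this[of "\<lambda>l. cis (\<theta> l)"] show "vertex v i = vertex u i" unfolding path_vertex_def using pre by metis
  show "y < level v (Suc i)" using j ij by simp
  show "v (Suc i) = u (Suc i)" if "level u i < y"
  proof -
    have "{l \<in> {1..n}. 0 < share u l y} = {l \<in> {1..n}. 0 < share v l y}"
      using eq by auto
    then have "u ` {1..Suc i} = v ` {1..Suc i}"
      using full_labels(2)[OF u i y] full_labels(2)[OF v j] ij lev that by simp
    moreover have "{1..Suc i} = insert (Suc i) {1..i}" by auto
    ultimately have "insert (u (Suc i)) (u ` {1..i}) = insert (v (Suc i)) (u ` {1..i})"
      using pre by (metis image_insert)
    moreover have "u (Suc i) \<notin> u ` {1..i}" "v (Suc i) \<notin> v ` {1..i}"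
      by (auto simp: inj_eq[OF permutes_inj[OF u]] inj_eq[OF permutes_inj[OF v]])
    ultimately show ?thesis using pre by blast
  qed
qed

end

subsection \<open>Rhombi\<close>

definition parallelogram :: "complex \<Rightarrow> complex \<Rightarrow> complex \<Rightarrow> complex set" where
  "parallelogram p a b = {p + s *\<^sub>R a + t *\<^sub>R b |s t. 0 \<le> s \<and> s \<le> 1 \<and> 0 \<le> t \<and> t \<le> 1}"

lemma parallelogramI:
  "0 \<le> s \<Longrightarrow> s \<le> 1 \<Longrightarrow> 0 \<le> t \<Longrightarrow> t \<le> 1 \<Longrightarrow> p + s *\<^sub>R a + t *\<^sub>R b \<in> parallelogram p a b"
  by (auto simp: parallelogram_def)

lemma parallelogram_eq_hull: "convex hull {p, p + a, p + b, p + a + b} = parallelogram p a b"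
proof (rule subset_antisym)
  have "convex (parallelogram p a b)"
  proof (rule convexI)
    fix x y :: complex and e f :: real
    assume "x \<in> parallelogram p a b" "y \<in> parallelogram p a b" and l: "0 \<le> e" "0 \<le> f" "e + f = 1"
    then obtain s t s' t' where xy: "x = p + s *\<^sub>R a + t *\<^sub>R b" "y = p + s' *\<^sub>R a + t' *\<^sub>R b"
      and st: "0 \<le> s" "s \<le> 1" "0 \<le> t" "t \<le> 1" "0 \<le> s'" "s' \<le> 1" "0 \<le> t'" "t' \<le> 1"
      by (auto simp: parallelogram_def)
    have "e *\<^sub>R x + f *\<^sub>R y = (e + f) *\<^sub>R p + (e * s + f * s') *\<^sub>R a + (e * t + f * t') *\<^sub>R b"
      by (simp add: xy algebra_simps)
    moreover have "e * s + f * s' \<le> 1" "e * t + f * t' \<le> 1"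
      using convex_bound_le[of s 1 s' e f] convex_bound_le[of t 1 t' e f] st l by auto
    ultimately show "e *\<^sub>R x + f *\<^sub>R y \<in> parallelogram p a b"
      unfolding parallelogram_def using st l
      by (intro CollectI exI[of _ "e * s + f * s'"] exI[of _ "e * t + f * t'"]) simp
  qed
  moreover have "p \<in> parallelogram p a b" "p + a \<in> parallelogram p a b"
    "p + b \<in> parallelogram p a b" "p + a + b \<in> parallelogram p a b"
    using parallelogramI[of 0 0 p a b] parallelogramI[of 1 0 p a b]
      parallelogramI[of 0 1 p a b] parallelogramI[of 1 1 p a b] by simp_all
  ultimately show "convex hull {p, p + a, p + b, p + a + b} \<subseteq> parallelogram p a b"
    by (intro hull_minimal) auto
next
  let ?H = "convex hull {p, p + a, p + b, p + a + b}"
  have c: "convex ?H" by simp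
  have v: "p \<in> ?H" "p + a \<in> ?H" "p + b \<in> ?H" "p + a + b \<in> ?H"
    by (auto intro: hull_inc)
  show "parallelogram p a b \<subseteq> ?H"
  proof
    fix z assume "z \<in> parallelogram p a b"
    then obtain s t where z: "z = p + s *\<^sub>R a + t *\<^sub>R b" and st: "0 \<le> s" "s \<le> 1" "0 \<le> t" "t \<le> 1"
      by (auto simp: parallelogram_def)
    have h: "(1 - s) *\<^sub>R p + s *\<^sub>R (p + a) \<in> ?H" "(1 - s) *\<^sub>R (p + b) + s *\<^sub>R (p + a + b) \<in> ?H"
      using st convexD[OF c v(1,2), of "1 - s" s] convexD[OF c v(3,4), of "1 - s" s] by simp_all
    have "(1 - t) *\<^sub>R ((1 - s) *\<^sub>R p + s *\<^sub>R (p + a)) + t *\<^sub>R ((1 - s) *\<^sub>R (p + b) + s *\<^sub>R (p + a + b)) \<in> ?H"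
      by (rule convexD[OF c h]) (use st in auto)
    moreover have "(1 - t) *\<^sub>R ((1 - s) *\<^sub>R p + s *\<^sub>R (p + a)) + t *\<^sub>R ((1 - s) *\<^sub>R (p + b) + s *\<^sub>R (p + a + b)) = z"
      by (simp add: z algebra_simps)
    ultimately show "z \<in> ?H" by simp
  qed
qed

text \<open>Starts at the next corner, so that a fact about the first edge of a parallelogram also
  yields the second.\<close>

lemma parallelogram_rotate: "parallelogram p a b = parallelogram (p + a) b (- a)"
proof -
  have "{p, p + a, p + b, p + a + b} = {p + a, p + a + b, p + a + - a, p + a + b + - a}"
    by auto
  then show ?thesis unfolding parallelogram_eq_hull[symmetric] by simp
qed

lemma parallelogram_commute: "parallelogram p a b = parallelogram p b a"
proof -
  have "{p, p + a, p + b, p + a + b} = {p, p + b, p + a, p + b + a}"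
    by auto
  then show ?thesis unfolding parallelogram_eq_hull[symmetric] by simp
qed

lemma parallelogram_edge_face:
  assumes "Re a * Im b - Im a * Re b \<noteq> 0"
  shows "closed_segment p (p + a) face_of parallelogram p a b"
proof -
  \<comment> \<open>The direction \<open>a\<close> turned by a right angle: the inner product with
    it is constant along \<open>a\<close> and detects the coefficient of \<open>b\<close>, so the
    edge is cut out by a supporting line.\<close>
  define c where "c = Complex (- Im a) (Re a)"
  define \<sigma> where "\<sigma> = Re a * Im b - Im a * Re b"
  have \<sigma>: "\<sigma> \<noteq> 0" using assms by (simp add: \<sigma>_def)
  have val: "c \<bullet> (p + s *\<^sub>R a + t *\<^sub>R b) = c \<bullet> p + t * \<sigma>" for s t
    by (simp add: c_def \<sigma>_def inner_complex_def algebra_simps)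
  have conv: "convex (parallelogram p a b)"
    unfolding parallelogram_eq_hull[symmetric] by simp
  have "closed_segment p (p + a) = parallelogram p a b \<inter> {x. c \<bullet> x = c \<bullet> p}"
  proof (rule subset_antisym; rule subsetI)
    fix z assume "z \<in> closed_segment p (p + a)"
    then obtain s where s: "0 \<le> s" "s \<le> 1" "z = (1 - s) *\<^sub>R p + s *\<^sub>R (p + a)"
      by (auto simp: in_segment)
    then have z: "z = p + s *\<^sub>R a + 0 *\<^sub>R b" by (simp add: algebra_simps)
    have "c \<bullet> z = c \<bullet> p" using val[of s 0] z by simp
    moreover have "z \<in> parallelogram p a b" unfolding parallelogram_def
      using s z by (intro CollectI exI[of _ s] exI[of _ 0]) simp
    ultimately show "z \<in> parallelogram p a b \<inter> {x. c \<bullet> x = c \<bullet> p}" by simp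
  next
    fix z assume z: "z \<in> parallelogram p a b \<inter> {x. c \<bullet> x = c \<bullet> p}"
    then obtain s t where st: "z = p + s *\<^sub>R a + t *\<^sub>R b" "0 \<le> s" "s \<le> 1"
      by (auto simp: parallelogram_def)
    then have "t * \<sigma> = 0" using val[of s t] z by simp
    then have "t = 0" using \<sigma> by simp
    then show "z \<in> closed_segment p (p + a)"
      unfolding in_segment using st by (intro exI[of _ s]) (simp add: algebra_simps)
  qed
  moreover have "(parallelogram p a b \<inter> {x. c \<bullet> x = c \<bullet> p}) face_of parallelogram p a b"
  proof (cases "\<sigma> > 0")
    case True
    then show ?thesis
      by (intro face_of_Int_supporting_hyperplane_ge conv) (auto simp: parallelogram_def val)
  next
    case False
    then show ?thesis
      by (intro face_of_Int_supporting_hyperplane_le conv) (auto simp: parallelogram_def val mult_nonneg_nonpos)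
  qed
  ultimately show ?thesis by simp
qed

lemma rhombus_eq_parallelogram:
  "rhombus \<theta> p i j = parallelogram p (cis (\<theta> i)) (cis (\<theta> j))"
  by (simp only: rhombus_def parallelogram_eq_hull)

lemma rhombus_commute: "rhombus \<theta> p i j = rhombus \<theta> p j i"
  unfolding rhombus_eq_parallelogram by (rule parallelogram_commute)

lemma convex_rhombus: "convex (rhombus \<theta> p i j)"
  by (simp add: rhombus_def)

lemma closed_rhombus: "closed (rhombus \<theta> p i j)"
  unfolding rhombus_def by (intro compact_imp_closed compact_convex_hull finite_imp_compact) auto

text \<open>The exchanged positions \<open>Suc j\<close> and \<open>Suc (Suc j)\<close> are
  separated only by the partial sum up to \<open>Suc j\<close>.\<close>

lemma sum_swap_at:
  assumes "k \<noteq> Suc j"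
  shows "(\<Sum>i=1..k. g (swap_at (Suc j) u i)) = (\<Sum>i=1..k. g (u i :: nat) :: 'a::comm_monoid_add)"
proof -
  have low: "(\<Sum>i=1..j. g (swap_at (Suc j) u i)) = (\<Sum>i=1..j. g (u i))"
    by (intro sum.cong) (auto simp: swap_at_def Transposition.transpose_def)
  show ?thesis using assms
  proof (induction k)
    case (Suc k)
    show ?case
    proof (cases "k = Suc j")
      case True
      then show ?thesis using low by (simp add: swap_at_def add.assoc) (simp add: add.commute)
    next
      case False
      then have "swap_at (Suc j) u (Suc k) = u (Suc k)"
        using Suc.prems by (simp add: swap_at_def)
      then show ?thesis using Suc.IH False by simp
    qed
  qed simp
qed

context angles
begin

definition region :: "(nat \<Rightarrow> nat) \<Rightarrow> (nat \<Rightarrow> nat) \<Rightarrow> complex set" where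
  "region u w = {z. 0 \<le> depth z \<and> depth z \<le> total \<and>
     path_x u (depth z) \<le> Re z \<and> Re z \<le> path_x w (depth z)}"

definition tile :: "(nat \<Rightarrow> nat) \<Rightarrow> nat \<Rightarrow> complex set" where
  "tile u j = rhombus \<theta> (vertex u j) (u (Suc j)) (u (Suc (Suc j)))"

lemma cross_nonzero:
  assumes "i \<in> {1..n}" "j \<in> {1..n}" "i \<noteq> j"
  shows "Re (cis (\<theta> i)) * Im (cis (\<theta> j)) - Im (cis (\<theta> i)) * Re (cis (\<theta> j)) \<noteq> 0"
proof
  assume "Re (cis (\<theta> i)) * Im (cis (\<theta> j)) - Im (cis (\<theta> i)) * Re (cis (\<theta> j)) = 0"
  then have "cos (\<theta> i) * height j = cos (\<theta> j) * height i" by (simp add: height_def)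
  then have "slope i = slope j"
    using height_pos[OF assms(1)] height_pos[OF assms(2)] by (simp add: slope_def frac_eq_eq)
  then show False using slope_less_iff[OF assms(1,2)] slope_less_iff[OF assms(2,1)] assms(3) by auto
qed

lemma rhombus_edge_faces:
  assumes "i \<in> {1..n}" "j \<in> {1..n}" "i \<noteq> j"
  shows "closed_segment p (p + cis (\<theta> i)) face_of rhombus \<theta> p i j"
    and "closed_segment (p + cis (\<theta> i)) (p + cis (\<theta> i) + cis (\<theta> j)) face_of rhombus \<theta> p i j"
proof -
  show "closed_segment p (p + cis (\<theta> i)) face_of rhombus \<theta> p i j"
    unfolding rhombus_eq_parallelogram using cross_nonzero[OF assms] by (rule parallelogram_edge_face)
  have "Re (cis (\<theta> j)) * Im (- cis (\<theta> i)) - Im (cis (\<theta> j)) * Re (- cis (\<theta> i)) \<noteq> 0"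
    using cross_nonzero[OF assms] by (simp add: algebra_simps)
  from parallelogram_edge_face[OF this, of "p + cis (\<theta> i)"]
  show "closed_segment (p + cis (\<theta> i)) (p + cis (\<theta> i) + cis (\<theta> j)) face_of rhombus \<theta> p i j"
    unfolding rhombus_eq_parallelogram using parallelogram_rotate by metis
qed

text \<open>The coordinates are measured in depth instead of in \<open>[0, 1]\<close>; depth is then
  their sum, and the abscissa their combination by slopes.\<close>

lemma rhombus_coordinates:
  assumes a: "a \<in> {1..n}" and b: "b \<in> {1..n}"
  shows "z \<in> rhombus \<theta> p a b \<longleftrightarrow> (\<exists>S T. 0 \<le> S \<and> S \<le> height a \<and> 0 \<le> T \<and> T \<le> height b \<and>
    depth z - depth p = S + T \<and> Re z - Re p = slope a * S + slope b * T)"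
proof
  assume "z \<in> rhombus \<theta> p a b"
  then obtain s t where st: "0 \<le> s" "s \<le> 1" "0 \<le> t" "t \<le> 1" "z = p + s *\<^sub>R cis (\<theta> a) + t *\<^sub>R cis (\<theta> b)"
    by (auto simp: rhombus_eq_parallelogram parallelogram_def)
  then show "\<exists>S T. 0 \<le> S \<and> S \<le> height a \<and> 0 \<le> T \<and> T \<le> height b \<and>
    depth z - depth p = S + T \<and> Re z - Re p = slope a * S + slope b * T"
    using height_pos[OF a] height_pos[OF b] Re_cis_slope[OF a] Re_cis_slope[OF b]
    by (intro exI[of _ "s * height a"] exI[of _ "t * height b"])
      (simp add: mult_left_le_one_le del: cis.sel)
next
  assume "\<exists>S T. 0 \<le> S \<and> S \<le> height a \<and> 0 \<le> T \<and> T \<le> height b \<and>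
    depth z - depth p = S + T \<and> Re z - Re p = slope a * S + slope b * T"
  then obtain S T where ST: "0 \<le> S" "S \<le> height a" "0 \<le> T" "T \<le> height b"
    "depth z - depth p = S + T" "Re z - Re p = slope a * S + slope b * T" by blast
  have "z = p + (S / height a) *\<^sub>R cis (\<theta> a) + (T / height b) *\<^sub>R cis (\<theta> b)"
    unfolding complex_eq_depth
    using ST height_pos[OF a] height_pos[OF b] Re_cis_slope[OF a] Re_cis_slope[OF b]
    by (simp add: field_simps del: cis.sel)
  then show "z \<in> rhombus \<theta> p a b"
    unfolding rhombus_eq_parallelogram parallelogram_def
    using ST height_pos[OF a] height_pos[OF b]
    by (intro CollectI exI[of _ "S / height a"] exI[of _ "T / height b"]) simp
qed

text \<open>At depth \<open>d\<close> a point is determined by its coordinate \<open>T\<close> along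
  \<open>b\<close>, as \<open>x = slope a * d + (slope b - slope a) * T\<close>, and the admissible
  \<open>T\<close> form the interval from \<open>max 0 (d - height a)\<close> to
  \<open>min d (height b)\<close>. Its ends are the two sides of the rhombus.\<close>

lemma rhombus_iff:
  assumes a: "a \<in> {1..n}" and b: "b \<in> {1..n}" and ab: "a < b"
  shows "z \<in> rhombus \<theta> p a b \<longleftrightarrow> (let d = depth z - depth p; x = Re z - Re p in
    0 \<le> d \<and> d \<le> height a + height b \<and>
    slope a * min d (height a) + slope b * max 0 (d - height a) \<le> x \<and>
    x \<le> slope b * min d (height b) + slope a * max 0 (d - height b))"
proof -
  define d where "d = depth z - depth p"
  define x where "x = Re z - Re p"
  define \<Delta> where "\<Delta> = slope b - slope a"
  have \<Delta>: "0 < \<Delta>" using slope_less[OF a b ab] by (simp add: \<Delta>_def)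
  have sb: "slope b = slope a + \<Delta>" by (simp add: \<Delta>_def)
  have lower: "slope a * min d (height a) + slope b * max 0 (d - height a) = slope a * d + \<Delta> * max 0 (d - height a)"
    by (simp add: sb min_def max_def algebra_simps)
  have upper: "slope b * min d (height b) + slope a * max 0 (d - height b) = slope a * d + \<Delta> * min d (height b)"
    by (simp add: sb min_def max_def algebra_simps)
  have "z \<in> rhombus \<theta> p a b \<longleftrightarrow> 0 \<le> d \<and> d \<le> height a + height b \<and>
    slope a * d + \<Delta> * max 0 (d - height a) \<le> x \<and> x \<le> slope a * d + \<Delta> * min d (height b)"
  proof
    assume "z \<in> rhombus \<theta> p a b"
    then obtain S T where ST: "0 \<le> S" "S \<le> height a" "0 \<le> T" "T \<le> height b"
      "d = S + T" "x = slope a * S + slope b * T"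
      unfolding rhombus_coordinates[OF a b] d_def[symmetric] x_def[symmetric] by blast
    have x: "x = slope a * d + \<Delta> * T" using ST by (simp add: sb algebra_simps)
    have "max 0 (d - height a) \<le> T" "T \<le> min d (height b)" using ST by auto
    then have "\<Delta> * max 0 (d - height a) \<le> \<Delta> * T" "\<Delta> * T \<le> \<Delta> * min d (height b)"
      using \<Delta> by simp_all
    then show "0 \<le> d \<and> d \<le> height a + height b \<and>
      slope a * d + \<Delta> * max 0 (d - height a) \<le> x \<and> x \<le> slope a * d + \<Delta> * min d (height b)"
      using ST(1-5) x by linarith
  next
    assume R: "0 \<le> d \<and> d \<le> height a + height b \<and>
      slope a * d + \<Delta> * max 0 (d - height a) \<le> x \<and> x \<le> slope a * d + \<Delta> * min d (height b)"
    define T where "T = (x - slope a * d) / \<Delta>"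
    have x: "x = slope a * d + \<Delta> * T" using \<Delta> by (simp add: T_def)
    have "max 0 (d - height a) \<le> T" "T \<le> min d (height b)" using R \<Delta> x by (simp_all del: max.bounded_iff min.bounded_iff)
    then show "z \<in> rhombus \<theta> p a b"
      unfolding rhombus_coordinates[OF a b] d_def[symmetric] x_def[symmetric]
      using x by (intro exI[of _ "d - T"] exI[of _ T]) (auto simp: sb algebra_simps)
  qed
  then show ?thesis unfolding d_def[symmetric] x_def[symmetric] lower upper Let_def .
qed

lemma level_swap_at: "k \<noteq> Suc j \<Longrightarrow> level (swap_at (Suc j) u) k = level u k"
  unfolding level_def by (rule sum_swap_at)

lemma vertex_swap_at: "k \<noteq> Suc j \<Longrightarrow> vertex (swap_at (Suc j) u) k = vertex u k"
  unfolding path_vertex_def by (rule sum_swap_at)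

lemma swap_at_values:
  "swap_at (Suc j) u (Suc j) = u (Suc (Suc j))" "swap_at (Suc j) u (Suc (Suc j)) = u (Suc j)"
  "i \<noteq> j \<Longrightarrow> i \<noteq> Suc j \<Longrightarrow> swap_at (Suc j) u (Suc i) = u (Suc i)"
  by (simp_all add: swap_at_def)

lemma path_x_swap_at_outside:
  assumes u: "u permutes {1..n}" and j: "Suc j < n" and y: "0 \<le> y" "y \<le> total"
    and out: "y \<le> level u j \<or> level u (Suc (Suc j)) \<le> y"
  shows "path_x (swap_at (Suc j) u) y = path_x u y"
proof -
  have v: "swap_at (Suc j) u permutes {1..n}" using swap_at_permutes[OF u, of "Suc j"] j by simp
  obtain i where i: "i < n" "level u i \<le> y" "y \<le> level u (Suc i)"
    using exists_edge_closed[OF u y] j by auto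
  have vert: "y = level u k \<Longrightarrow> k \<noteq> Suc j \<Longrightarrow> k \<le> n \<Longrightarrow> ?thesis" for k
    using path_x_vertex[OF u, of k] path_x_vertex[OF v, of k] j
    by (simp add: level_swap_at vertex_swap_at)
  show ?thesis
  proof (cases "i = j \<or> i = Suc j")
    \<comment> \<open>Of the two exchanged edges only the outer end points have such a depth, and
      there both paths pass through the same vertex.\<close>
    case True
    then have "y = level u j \<or> y = level u (Suc (Suc j))"
      using out i level_mono[OF u, of j "Suc j"] level_mono[OF u, of "Suc j" "Suc (Suc j)"] j
        level_mono[OF u, of i "Suc i"] level_less[OF u, of j "Suc j"] level_less[OF u, of "Suc j" "Suc (Suc j)"]
      by auto
    then show ?thesis using vert[of j] vert[of "Suc (Suc j)"] j by auto
  next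
    case False
    then show ?thesis
      using path_x_at[OF u i] path_x_at[OF v i(1), of y] i
      by (simp add: level_swap_at vertex_swap_at swap_at_values)
  qed
qed

lemma path_x_local:
  assumes u: "u permutes {1..n}" and j: "Suc j < n"
    and y: "level u j \<le> y" "y \<le> level u (Suc (Suc j))"
  shows "path_x u y = Re (vertex u j) + (let d = y - level u j in
    slope (u (Suc j)) * min d (height (u (Suc j))) + slope (u (Suc (Suc j))) * max 0 (d - height (u (Suc j))))"
proof (cases "y \<le> level u (Suc j)")
  case True
  then show ?thesis using path_x_at[OF u _ y(1) True] j by (simp add: Let_def level_Suc)
next
  case False
  then show ?thesis
    using path_x_at[OF u j _ y(2)] Re_cis_slope[OF permutes_label[OF u, of j]] j
    by (simp add: Let_def level_Suc vertex_Suc del: cis.sel)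
qed

text \<open>The tile is swept out by the path in one swap: the two edges of \<open>u\<close> form
  its left side, and the same edges in the other order its right side.\<close>

lemma tile_iff:
  assumes u: "u permutes {1..n}" and j: "Suc j < n" and asc: "u (Suc j) < u (Suc (Suc j))"
  shows "z \<in> tile u j \<longleftrightarrow> level u j \<le> depth z \<and> depth z \<le> level u (Suc (Suc j)) \<and>
    path_x u (depth z) \<le> Re z \<and> Re z \<le> path_x (swap_at (Suc j) u) (depth z)"
proof -
  have v: "swap_at (Suc j) u permutes {1..n}" using swap_at_permutes[OF u, of "Suc j"] j by simp
  have "u (Suc j) \<in> {1..n}" "u (Suc (Suc j)) \<in> {1..n}" using permutes_label[OF u] j by simp_all
  note it = rhombus_iff[OF this asc, of z "vertex u j"]
  have lev: "level u (Suc (Suc j)) = level u j + height (u (Suc j)) + height (u (Suc (Suc j)))"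
    by (simp add: level_Suc)
  show ?thesis
  proof (cases "level u j \<le> depth z \<and> depth z \<le> level u (Suc (Suc j))")
    case True
    then show ?thesis
      unfolding tile_def it
      using path_x_local[OF u j, of "depth z"] path_x_local[OF v j, of "depth z"] lev
      by (simp add: Let_def level_swap_at vertex_swap_at swap_at_values) linarith
  next
    case False
    then show ?thesis unfolding tile_def it using lev by (auto simp: Let_def)
  qed
qed

end

subsection \<open>The polygon as a region between two paths\<close>

text \<open>If an open segment in \<open>R\<close> meets \<open>C\<close> in \<open>x\<close>, the
  face around \<open>x\<close> contains its end points, and this face lies in \<open>C\<close>. In
  this way an intersection of tiles is seen to be a face without finding out which one.\<close>

lemma face_of_covered:
  assumes "convex C" "C \<subseteq> R" and cov: "\<And>x. x \<in> C \<Longrightarrow> \<exists>F. x \<in> F \<and> F face_of R \<and> F \<subseteq> C"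
  shows "C face_of R"
  unfolding face_of_def using assms(1,2) cov by (auto simp: face_of_def) (meson subsetD)+

context angles
begin

lemma path_edge_Suc: "path_edge \<theta> u (Suc i) = closed_segment (vertex u i) (vertex u (Suc i))"
  by (simp add: path_edge_def)

lemma path_edge_iff:
  assumes u: "u permutes {1..n}" and i: "i < n"
  shows "z \<in> path_edge \<theta> u (Suc i) \<longleftrightarrow>
    level u i \<le> depth z \<and> depth z \<le> level u (Suc i) \<and> Re z = path_x u (depth z)"
proof -
  define h where "h = height (u (Suc i))"
  have h: "0 < h" using height_pos[OF permutes_label[OF u i]] by (simp add: h_def)
  have lev: "level u (Suc i) = level u i + h" by (simp add: level_Suc h_def)
  have xv: "Re (vertex u (Suc i)) = Re (vertex u i) + slope (u (Suc i)) * h"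
    using Re_cis_slope[OF permutes_label[OF u i]] by (simp add: vertex_Suc h_def del: cis.sel)
  have seg: "z = (1 - s) *\<^sub>R vertex u i + s *\<^sub>R vertex u (Suc i) \<longleftrightarrow>
    depth z = level u i + s * h \<and> Re z = Re (vertex u i) + slope (u (Suc i)) * (s * h)" for s
    unfolding complex_eq_depth by (simp add: lev xv algebra_simps) blast
  show ?thesis
  proof
    assume "z \<in> path_edge \<theta> u (Suc i)"
    then obtain s where s: "0 \<le> s" "s \<le> 1" "depth z = level u i + s * h"
      "Re z = Re (vertex u i) + slope (u (Suc i)) * (s * h)"
      unfolding path_edge_Suc in_segment seg by blast
    then have "level u i \<le> depth z" "depth z \<le> level u (Suc i)"
      using h lev by (simp_all add: mult_left_le_one_le)
    then show "level u i \<le> depth z \<and> depth z \<le> level u (Suc i) \<and> Re z = path_x u (depth z)"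
      using path_x_at[OF u i] s by simp
  next
    assume R: "level u i \<le> depth z \<and> depth z \<le> level u (Suc i) \<and> Re z = path_x u (depth z)"
    define s where "s = (depth z - level u i) / h"
    have sh: "s * h = depth z - level u i" using h by (simp add: s_def)
    have "0 \<le> s" "s \<le> 1" using R h lev by (simp_all add: s_def)
    then show "z \<in> path_edge \<theta> u (Suc i)"
      unfolding path_edge_Suc in_segment seg using path_x_at[OF u i, of "depth z"] R
      by (intro exI[of _ s]) (simp add: sh)
  qed
qed

lemma Union_path_edges:
  assumes u: "u permutes {1..n}" and n: "0 < n"
  shows "(\<Union>k\<in>{1..n}. path_edge \<theta> u k) =
    {z. 0 \<le> depth z \<and> depth z \<le> total \<and> Re z = path_x u (depth z)}"
proof (intro set_eqI iffI)
  fix z assume "z \<in> (\<Union>k\<in>{1..n}. path_edge \<theta> u k)"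
  then obtain k where k: "k \<in> {1..n}" "z \<in> path_edge \<theta> u k" by blast
  define i where "i = k - 1"
  have i: "k = Suc i" "i < n" using k(1) by (auto simp: i_def)
  then show "z \<in> {z. 0 \<le> depth z \<and> depth z \<le> total \<and> Re z = path_x u (depth z)}"
    using k(2) path_edge_iff[OF u i(2), of z] level_mono[OF u, of 0 i] level_mono[OF u, of "Suc i" n] level_n[OF u]
    by auto
next
  fix z assume z: "z \<in> {z. 0 \<le> depth z \<and> depth z \<le> total \<and> Re z = path_x u (depth z)}"
  then obtain i where i: "i < n" "level u i \<le> depth z" "depth z \<le> level u (Suc i)"
    using exists_edge_closed[OF u _ _ n, of "depth z"] by auto
  then have "z \<in> path_edge \<theta> u (Suc i)" using path_edge_iff[OF u] z by simp
  then show "z \<in> (\<Union>k\<in>{1..n}. path_edge \<theta> u k)" using i(1) by (intro UN_I[of "Suc i"]) auto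
qed

lemma polygon_boundary_eq:
  assumes w: "w permutes {1..n}" and n: "0 < n"
  shows "polygon_boundary n \<theta> w = {z. 0 \<le> depth z \<and> depth z \<le> total \<and>
    (Re z = path_x id (depth z) \<or> Re z = path_x w (depth z))}"
  unfolding polygon_boundary_def Union_path_edges[OF permutes_id n] Union_path_edges[OF w n] by auto

lemma path_x_ends:
  assumes u: "u permutes {1..n}" and w: "w permutes {1..n}" and n: "0 < n"
  shows "path_x u 0 = path_x w 0" "path_x u total = path_x w total"
proof -
  show "path_x u 0 = path_x w 0"
    using path_x_vertex[OF u, of 0] path_x_vertex[OF w, of 0] n by simp
  have "vertex u n = (\<Sum>l\<in>{1..n}. cis (\<theta> l))" if "u permutes {1..n}" for u
    using sum.permute[OF that, of "\<lambda>l. cis (\<theta> l)"] by (simp add: path_vertex_def)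
  then show "path_x u total = path_x w total"
    using path_x_vertex[OF u, of n] path_x_vertex[OF w, of n] n level_n[OF u] level_n[OF w] u w by simp
qed

lemma continuous_depth [continuous_intros]:
  "continuous_on S f \<Longrightarrow> continuous_on S (\<lambda>x. depth (f x))"
  unfolding depth_def by (intro continuous_intros)

lemma continuous_path_x_depth [continuous_intros]:
  "continuous_on S f \<Longrightarrow> continuous_on S (\<lambda>x. path_x u (depth (f x)))"
  by (rule continuous_on_compose2[OF continuous_path_x]) (auto intro: continuous_intros)

lemma path_x_bounded: "\<exists>M. \<forall>y. 0 \<le> y \<and> y \<le> total \<longrightarrow> \<bar>path_x u y\<bar> \<le> M"
proof -
  have "compact (path_x u ` {0..total})"
    by (intro compact_continuous_image continuous_on_subset[OF continuous_path_x]) auto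
  then obtain M where "\<forall>x\<in>path_x u ` {0..total}. norm x \<le> M"
    using compact_imp_bounded bounded_iff by metis
  then show ?thesis by (intro exI[of _ M]) auto
qed

lemma bounded_region: "bounded (region u w)"
proof -
  obtain M N where M: "\<forall>y. 0 \<le> y \<and> y \<le> total \<longrightarrow> \<bar>path_x u y\<bar> \<le> M"
    and N: "\<forall>y. 0 \<le> y \<and> y \<le> total \<longrightarrow> \<bar>path_x w y\<bar> \<le> N"
    using path_x_bounded by metis
  have "norm z \<le> max M N + total" if "z \<in> region u w" for z
  proof -
    have "\<bar>Re z\<bar> \<le> max M N" "\<bar>Im z\<bar> \<le> total"
      using M[rule_format, of "depth z"] N[rule_format, of "depth z"] that
      by (auto simp: region_def depth_def)
    then show ?thesis using cmod_le[of z] by simp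
  qed
  then show ?thesis unfolding bounded_iff by blast
qed

text \<open>The ray is connected and unbounded, and avoiding \<open>B\<close> it stays in the
  component of its starting point.\<close>

lemma horizontal_ray_unbounded:
  fixes z :: complex
  assumes "c = 1 \<or> c = - (1::real)" and ray: "\<And>t. 0 \<le> t \<Longrightarrow> z + of_real (c * t) \<notin> B"
  shows "z \<notin> inside B"
proof
  assume "z \<in> inside B"
  then have b: "bounded (connected_component_set (- B) z)" by (simp add: inside_def)
  define r where "r = (\<lambda>t. z + of_real (c * t)) ` {0..}"
  have "continuous_on {0..} (\<lambda>t. z + of_real (c * t))" by (intro continuous_intros)
  then have "connected r" unfolding r_def
    by (rule connected_continuous_image) (rule connected_Ici)
  moreover have "z \<in> r" unfolding r_def by (intro image_eqI[of _ _ 0]) auto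
  moreover have "r \<subseteq> - B" using ray by (auto simp: r_def)
  ultimately have "r \<subseteq> connected_component_set (- B) z" by (intro connected_component_maximal)
  then have "bounded r" using b bounded_subset by blast
  then obtain K where K: "\<forall>x\<in>r. norm x \<le> K" using bounded_iff by metis
  define t where "t = \<bar>K\<bar> + norm z + 1"
  have "0 \<le> t" by (simp add: t_def)
  then have "norm (z + of_real (c * t)) \<le> K" using K by (auto simp: r_def)
  moreover have "norm (complex_of_real (c * t)) = t" using assms(1) \<open>0 \<le> t\<close> by (auto simp: norm_of_real)
  ultimately have "t \<le> K + norm z"
    using norm_triangle_ineq4[of "z + of_real (c * t)" z] by simp
  then show False by (simp add: t_def)
qed

text \<open>Takes the place of the Jordan curve theorem: the complement of the boundary splits into
  two open sets, strictly between the paths and outside. A component that meets the first stays in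
  it and is bounded; from the second a horizontal ray escapes.\<close>

lemma elnitsky_polygon_eq_region:
  assumes w: "w permutes {1..n}" and n: "0 < n"
    and less: "\<And>y. 0 < y \<Longrightarrow> y < total \<Longrightarrow> path_x id y < path_x w y"
  shows "elnitsky_polygon n \<theta> w = region id w"
proof -
  define B where "B = polygon_boundary n \<theta> w"
  have B: "z \<in> B \<longleftrightarrow> 0 \<le> depth z \<and> depth z \<le> total \<and>
    (Re z = path_x id (depth z) \<or> Re z = path_x w (depth z))" for z
    unfolding B_def polygon_boundary_eq[OF w n] by simp
  have ends: "path_x id y = path_x w y" if "y = 0 \<or> y = total" for y
    using path_x_ends[OF permutes_id w n] that by auto
  have le: "path_x id y \<le> path_x w y" if "0 \<le> y" "y \<le> total" for y
    using ends[of y] less[of y] that by force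
  define U where "U = {z. 0 < depth z \<and> depth z < total \<and> path_x id (depth z) < Re z \<and> Re z < path_x w (depth z)}"
  define V where "V = {z. depth z < 0 \<or> total < depth z \<or> Re z < path_x id (depth z) \<or> path_x w (depth z) < Re z}"
  have openU: "open U" unfolding U_def
    by (intro open_Collect_conj open_Collect_less continuous_intros)
  have openV: "open V" unfolding V_def
    by (intro open_Collect_disj open_Collect_less continuous_intros)
  have disj: "U \<inter> V = {}" by (auto simp: U_def V_def)
  have cover: "z \<in> U \<or> z \<in> V" if "z \<notin> B" for z
  proof (cases "0 < depth z \<and> depth z < total")
    case True
    then show ?thesis using that B[of z] by (auto simp: U_def V_def)
  next
    case False
    then show ?thesis using that B[of z] ends[of "depth z"] by (auto simp: U_def V_def)
  qed
  have "z \<in> inside B" if z: "z \<in> U" for z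
  proof -
    have zB: "z \<notin> B" using z B[of z] by (auto simp: U_def)
    define C where "C = connected_component_set (- B) z"
    have "connected C" "C \<subseteq> - B" unfolding C_def
      by (simp_all add: connected_component_subset)
    moreover have "z \<in> C" using zB by (simp add: C_def)
    ultimately have "C \<inter> V = {}"
      using connectedD[of C U V] openU openV disj cover z by blast
    then have "C \<subseteq> U" using \<open>C \<subseteq> - B\<close> cover by blast
    also have "U \<subseteq> region id w" by (auto simp: U_def region_def)
    finally have "bounded C" using bounded_region bounded_subset by blast
    then show ?thesis using zB by (simp add: inside_def C_def)
  qed
  moreover have "z \<in> U" if z: "z \<in> inside B" for z
  proof (rule ccontr)
    assume "z \<notin> U"
    moreover have "z \<notin> B" using z by (simp add: inside_def)
    ultimately have "z \<in> V" using cover by blast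
    then consider "depth z < 0 \<or> total < depth z"
      | "0 \<le> depth z" "depth z \<le> total" "Re z < path_x id (depth z)"
      | "0 \<le> depth z" "depth z \<le> total" "path_x w (depth z) < Re z"
      by (fastforce simp: V_def)
    then show False
    proof cases
      case 1
      then show ?thesis using horizontal_ray_unbounded[of 1 z B] z B by auto
    next
      case 2
      then show ?thesis using horizontal_ray_unbounded[of "-1" z B] z B le[of "depth z"] by auto
    next
      case 3
      then show ?thesis using horizontal_ray_unbounded[of 1 z B] z B le[of "depth z"] by auto
    qed
  qed
  ultimately have "inside B = U" by blast
  moreover have "B \<union> U = region id w"
  proof (intro set_eqI iffI)
    fix z assume "z \<in> B \<union> U"
    then show "z \<in> region id w"
      using B[of z] le[of "depth z"] by (auto simp: U_def region_def)
  next
    fix z assume z: "z \<in> region id w"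
    show "z \<in> B \<union> U"
    proof (cases "z \<in> B")
      case False
      then have "path_x id (depth z) < Re z" "Re z < path_x w (depth z)"
        using z B[of z] by (auto simp: region_def)
      moreover from this have "depth z \<noteq> 0 \<and> depth z \<noteq> total" using ends[of "depth z"] by auto
      ultimately show ?thesis using z by (auto simp: U_def region_def)
    qed simp
  qed
  ultimately show ?thesis by (simp add: elnitsky_polygon_def B_def)
qed

text \<open>Paths that meet at depth \<open>y\<close> have finished the same set of labels, and for
  the leftside boundary this set is an initial interval.\<close>

lemma fully_supported_strict:
  assumes w: "w permutes {1..n}" and fs: "fully_supported n w" and n: "2 \<le> n"
    and y: "0 < y" "y < total"
  shows "path_x id y < path_x w y"
proof (rule ccontr)
  assume "\<not> ?thesis"
  moreover note id = permutes_id[of "{1..n}"]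
  note cmp = path_x_weak_le[OF id w weak_le_id, of y]
  ultimately have "path_x id y = path_x w y" using cmp(1) y n by force
  then have eq: "\<forall>l\<in>{1..n}. share id l y = share w l y" using cmp(2) y n by simp
  obtain i where i: "i < n" "level id i \<le> y" "y < level id (Suc i)"
    using exists_edge[OF id, of y] y by auto
  note cp = common_prefix[OF id w eq i]
  have pre: "w ` {1..i} = {1..i}" using cp(1) by simp
  show False
  proof (cases "i = 0")
    \<comment> \<open>No edge is finished and the common prefix is empty; \<open>y > 0\<close> makes
      the first edges agree instead, which gives a prefix of length 1.\<close>
    case True
    then have "w ` {1..1} = {1..1}" using cp(4) y by simp
    then show False using fs n by (auto simp: fully_supported_def)
  next
    case False
    then show False using fs i pre by (auto simp: fully_supported_def)
  qed
qed

lemma elnitsky_polygon_region: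
  assumes "w permutes {1..n}" "fully_supported n w" "2 \<le> n"
  shows "elnitsky_polygon n \<theta> w = region id w"
  using assms fully_supported_strict by (intro elnitsky_polygon_eq_region) auto

section \<open>Interiors of tiles and intersections of two tiles\<close>

lemma interior_shift:
  assumes "z \<in> interior (S :: complex set)"
  obtains e where "0 < e" "z + of_real e \<in> S" "z - of_real e \<in> S"
proof -
  obtain r where r: "0 < r" "ball z r \<subseteq> S" using assms mem_interior by metis
  have "z + of_real (r/2) \<in> ball z r" "z - of_real (r/2) \<in> ball z r"
    using r(1) by (simp_all add: dist_norm norm_divide)
  then have "z + of_real (r/2) \<in> S" "z - of_real (r/2) \<in> S" using r(2) by blast+
  then show ?thesis using r(1) by (intro that[of "r/2"]) simp_all
qed

lemma interior_right_of_path: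
  assumes "\<And>z. z \<in> S \<Longrightarrow> path_x u (depth z) \<le> Re z" "z \<in> interior S"
  shows "path_x u (depth z) < Re z"
proof -
  obtain e where "0 < e" "z - of_real e \<in> S" using interior_shift[OF assms(2)] by metis
  then show ?thesis using assms(1)[of "z - of_real e"] by simp
qed

lemma interior_left_of_path:
  assumes "\<And>z. z \<in> S \<Longrightarrow> Re z \<le> path_x u (depth z)" "z \<in> interior S"
  shows "Re z < path_x u (depth z)"
proof -
  obtain e where "0 < e" "z + of_real e \<in> S" using interior_shift[OF assms(2)] by metis
  then show ?thesis using assms(1)[of "z + of_real e"] by simp
qed

text \<open>The same tile read from its right side.\<close>

lemma tile_swap_at: "tile (swap_at (Suc j) u) j = tile u j"
  by (simp add: tile_def swap_at_values vertex_swap_at rhombus_commute)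

lemma label_neq: "u permutes {1..n} \<Longrightarrow> i \<noteq> j \<Longrightarrow> u i \<noteq> u j"
  using permutes_inj[of u "{1..n}"] by (simp add: inj_eq)

lemma tile_edge_face:
  assumes u: "u permutes {1..n}" and j: "Suc j < n" and i: "i = j \<or> i = Suc j"
  shows "path_edge \<theta> u (Suc i) face_of tile u j"
proof -
  have "u (Suc j) \<in> {1..n}" "u (Suc (Suc j)) \<in> {1..n}" "u (Suc j) \<noteq> u (Suc (Suc j))"
    using permutes_label[OF u] j label_neq[OF u] by simp_all
  from rhombus_edge_faces[OF this] show ?thesis
    using i by (auto simp: path_edge_Suc tile_def vertex_Suc)
qed

lemma tile_vertex_face:
  assumes u: "u permutes {1..n}" and j: "Suc j < n" and k: "j \<le> k" "k \<le> Suc (Suc j)"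
  shows "{vertex u k} face_of tile u j"
proof -
  consider "k = j" | "k = Suc j" | "k = Suc (Suc j)" using k by linarith
  then obtain i where i: "i = j \<or> i = Suc j" "k = i \<or> k = Suc i" by cases auto
  have "{vertex u k} face_of path_edge \<theta> u (Suc i)"
    unfolding path_edge_Suc face_of_singleton extreme_point_of_segment using i(2) by auto
  then show ?thesis using tile_edge_face[OF u j i(1)] face_of_trans by blast
qed

lemma vertex_eqI:
  assumes u: "u permutes {1..n}" and "k \<le> n" "0 < n"
    and "depth z = level u k" "Re z = path_x u (depth z)"
  shows "z = vertex u k"
  unfolding complex_eq_depth using assms path_x_vertex[OF u] by simp

text \<open>The first tile lies to the left of the swapped path and the second to the right of
  \<open>w\<close>, so a common point lies on both paths. There \<open>common_prefix\<close> gives a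
  common vertex or a common edge, which is a face of either tile.\<close>

lemma tiles_meet_in_faces:
  assumes u: "u permutes {1..n}" and j: "Suc j < n" and asc: "u (Suc j) < u (Suc (Suc j))"
    and w: "w permutes {1..n}" and k: "Suc k < n" and asc': "w (Suc k) < w (Suc (Suc k))"
    and le: "weak_le n (swap_at (Suc j) u) w"
  shows "(tile u j \<inter> tile w k) face_of tile u j" "(tile u j \<inter> tile w k) face_of tile w k"
proof -
  define v where "v = swap_at (Suc j) u"
  have v: "v permutes {1..n}" using swap_at_permutes[OF u, of "Suc j"] j by (simp add: v_def)
  have tv: "tile u j = tile v j" by (simp add: v_def tile_swap_at)
  have n: "0 < n" using j by simp
  have "\<exists>F. z \<in> F \<and> F face_of tile v j \<and> F face_of tile w k" if z: "z \<in> tile u j \<inter> tile w k" for z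
  proof -
    define y where "y = depth z"
    have zu: "level v j \<le> y" "y \<le> level v (Suc (Suc j))" "Re z \<le> path_x v y"
      using z tile_iff[OF u j asc, of z] by (auto simp: y_def v_def level_swap_at)
    have zw: "level w k \<le> y" "y \<le> level w (Suc (Suc k))" "path_x w y \<le> Re z"
      using z tile_iff[OF w k asc', of z] by (auto simp: y_def)
    have y: "0 \<le> y" "y \<le> total"
      using zu level_mono[OF v, of 0 j] level_mono[OF v, of "Suc (Suc j)" n] j level_n[OF v] by auto
    note cmp = path_x_weak_le[OF v w le[folded v_def] y n]
    have eqs: "Re z = path_x v y" "Re z = path_x w y" using cmp(1) zu zw by auto
    then have sh: "\<forall>l\<in>{1..n}. share v l y = share w l y" using cmp(2) by simp
    show ?thesis
    proof (cases "y = total")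
      \<comment> \<open>The half-open choice of an edge fails at this depth, but then the bottom
        vertex is the lowest vertex of both tiles.\<close>
      case True
      have "Suc (Suc j) = n" using level_less[OF v, of "Suc (Suc j)" n] zu(2) True level_n[OF v] j by force
      moreover have "Suc (Suc k) = n" using level_less[OF w, of "Suc (Suc k)" n] zw(2) True level_n[OF w] k by force
      moreover have "z = vertex v n" "z = vertex w n"
        using vertex_eqI[OF v, of n z] vertex_eqI[OF w, of n z] True eqs level_n[OF v] level_n[OF w] n
        by (auto simp: y_def)
      ultimately show ?thesis
        using tile_vertex_face[OF v j, of n] tile_vertex_face[OF w k, of n]
        by (intro exI[of _ "{z}"]) auto
    next
      case False
      then obtain i where i: "i < n" "level v i \<le> y" "y < level v (Suc i)"
        using exists_edge[OF v, of y] y by auto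
      note cp = common_prefix[OF v w sh i]
      \<comment> \<open>The index of the edge at depth \<open>y\<close> is tied to the two edges of
        the tile: at a vertex three indices are possible, strictly below it only two.\<close>
      have range: "m \<le> i" "i \<le> Suc (Suc m)" "level t i < y \<Longrightarrow> i \<le> Suc m"
        if t: "t permutes {1..n}" and "level t i \<le> y" "y < level t (Suc i)" "Suc m < n"
          "level t m \<le> y" "y \<le> level t (Suc (Suc m))" for t m
      proof -
        show "m \<le> i" using level_mono[OF t, of "Suc i" m] that by force
        show "i \<le> Suc (Suc m)" using level_less[OF t, of "Suc (Suc m)" i] that i(1) by force
        show "i \<le> Suc m" if "level t i < y"
          using level_mono[OF t, of "Suc (Suc m)" i] that \<open>y \<le> level t (Suc (Suc m))\<close> i(1) by force
      qed
      have lw: "level w i \<le> y" using i cp(2) by simp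
      note rv = range[OF v i(2,3) j zu(1,2)]
      note rw = range[OF w lw cp(5) k zw(1,2)]
      show ?thesis
      proof (cases "y = level v i")
        case True
        then have "z = vertex v i" using vertex_eqI[OF v, of i z] i eqs n by (simp add: y_def)
        moreover have "vertex w i = vertex v i" by (rule cp(3))
        ultimately show ?thesis
          using tile_vertex_face[OF v j, of i] tile_vertex_face[OF w k, of i] rv(1,2) rw(1,2)
          by (intro exI[of _ "{z}"]) auto
      next
        case False
        then have lt: "level v i < y" using i by simp
        have eq: "path_edge \<theta> w (Suc i) = path_edge \<theta> v (Suc i)"
          using cp(3) cp(4)[OF lt] by (simp add: path_edge_Suc vertex_Suc)
        have "i = j \<or> i = Suc j" "i = k \<or> i = Suc k"
          using rv(1) rv(3)[OF lt] rw(1) rw(3) lt cp(2) by auto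
        then have "path_edge \<theta> v (Suc i) face_of tile v j" "path_edge \<theta> w (Suc i) face_of tile w k"
          by (intro tile_edge_face v w j k; simp)+
        moreover have "z \<in> path_edge \<theta> v (Suc i)"
          using path_edge_iff[OF v i(1), of z] i eqs by (simp add: y_def)
        ultimately show ?thesis using eq by auto
      qed
    qed
  qed
  then have cov: "\<exists>F. z \<in> F \<and> F face_of tile v j \<and> F face_of tile w k \<and> F \<subseteq> tile u j \<inter> tile w k"
    if "z \<in> tile u j \<inter> tile w k" for z
    using that tv face_of_imp_subset by (metis Int_subset_iff)
  have conv: "convex (tile u j \<inter> tile w k)"
    by (auto simp: tile_def intro: convex_Int convex_rhombus)
  show "(tile u j \<inter> tile w k) face_of tile u j"
  proof (rule face_of_covered[OF conv Int_lower1])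
    fix z assume "z \<in> tile u j \<inter> tile w k"
    from cov[OF this] show "\<exists>F. z \<in> F \<and> F face_of tile u j \<and> F \<subseteq> tile u j \<inter> tile w k"
      unfolding tv by blast
  qed
  show "(tile u j \<inter> tile w k) face_of tile w k"
  proof (rule face_of_covered[OF conv Int_lower2])
    fix z assume "z \<in> tile u j \<inter> tile w k"
    from cov[OF this] show "\<exists>F. z \<in> F \<and> F face_of tile w k \<and> F \<subseteq> tile u j \<inter> tile w k"
      by blast
  qed
qed

subsection \<open>Tilings from chains of swaps\<close>

text \<open>Seen from the common top \<open>p\<close>, all points of the containing rhombus lie in
  directions of slope between \<open>slope c\<close> and \<open>slope d\<close>, among them the two
  upper edges of the other one.\<close>

lemma rhombus_subset_labels:
  assumes a: "a \<in> {1..n}" and b: "b \<in> {1..n}" and ab: "a < b"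
    and c: "c \<in> {1..n}" and d: "d \<in> {1..n}" and cd: "c < d"
    and sub: "rhombus \<theta> p a b \<subseteq> rhombus \<theta> p c d"
  shows "c \<le> a \<and> b \<le> d"
proof -
  have sl: "slope c < slope d" using slope_less[OF c d cd] .
  have ha: "0 < height a" and hb: "0 < height b" using height_pos a b by auto
  have "p + cis (\<theta> a) \<in> rhombus \<theta> p a b" "p + cis (\<theta> b) \<in> rhombus \<theta> p a b"
    unfolding rhombus_def by (auto intro: hull_inc)
  then have mem: "p + cis (\<theta> a) \<in> rhombus \<theta> p c d" "p + cis (\<theta> b) \<in> rhombus \<theta> p c d"
    using sub by auto
  obtain S T where ST: "0 \<le> S" "0 \<le> T" "height a = S + T" "slope a * height a = slope c * S + slope d * T"
    using mem(1) Re_cis_slope[OF a] unfolding rhombus_coordinates[OF c d] by (auto simp del: cis.sel)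
  have "slope c * height a \<le> slope a * height a"
    using ST sl mult_right_mono[of "slope c" "slope d" T] by (simp add: algebra_simps)
  then have "slope c \<le> slope a" using ha by simp
  obtain S T where ST: "0 \<le> S" "0 \<le> T" "height b = S + T" "slope b * height b = slope c * S + slope d * T"
    using mem(2) Re_cis_slope[OF b] unfolding rhombus_coordinates[OF c d] by (auto simp del: cis.sel)
  have "slope b * height b \<le> slope d * height b"
    using ST sl mult_right_mono[of "slope c" "slope d" S] by (simp add: algebra_simps)
  then have "slope b \<le> slope d" using hb by simp
  show ?thesis using \<open>slope c \<le> slope a\<close> \<open>slope b \<le> slope d\<close> slope_le_iff a b c d by blast
qed

text \<open>The top is the only point of least depth in a rhombus.\<close>

lemma rhombus_top_unique:
  assumes a: "a \<in> {1..n}" and b: "b \<in> {1..n}" and c: "c \<in> {1..n}" and d: "d \<in> {1..n}"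
    and eq: "rhombus \<theta> p a b = rhombus \<theta> q c d"
  shows "p = q"
proof -
  have "p \<in> rhombus \<theta> p a b" "q \<in> rhombus \<theta> q c d"
    unfolding rhombus_def by (auto intro: hull_inc)
  then have mem: "p \<in> rhombus \<theta> q c d" "q \<in> rhombus \<theta> p a b" using eq by auto
  obtain S T where ST: "0 \<le> S" "0 \<le> T" "depth p - depth q = S + T" "Re p - Re q = slope c * S + slope d * T"
    using mem(1) unfolding rhombus_coordinates[OF c d] by auto
  obtain S' T' where ST': "0 \<le> S'" "0 \<le> T'" "depth q - depth p = S' + T'"
    using mem(2) unfolding rhombus_coordinates[OF a b] by auto
  have "S = 0" "T = 0" using ST ST' by linarith+
  then show ?thesis using ST by (simp add: complex_eq_depth)
qed

lemma rhombus_labels_unique: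
  assumes a: "a \<in> {1..n}" and b: "b \<in> {1..n}" and ab: "a < b"
    and c: "c \<in> {1..n}" and d: "d \<in> {1..n}" and cd: "c < d"
    and eq: "rhombus \<theta> p a b = rhombus \<theta> q c d"
  shows "a = c" "b = d"
proof -
  have pq: "p = q" by (rule rhombus_top_unique[OF a b c d eq])
  have "c \<le> a \<and> b \<le> d" by (rule rhombus_subset_labels[OF a b ab c d cd, of p]) (use eq pq in simp)
  moreover have "a \<le> c \<and> d \<le> b" by (rule rhombus_subset_labels[OF c d cd a b ab, of p]) (use eq pq in simp)
  ultimately show "a = c" "b = d" by auto
qed

lemma tile_closed_convex: "closed (tile u j)" "convex (tile u j)"
  by (simp_all add: tile_def closed_rhombus convex_rhombus)

text \<open>The tile is kept together with a path \<open>v\<close> that has it directly on the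
  right. The comparison with \<open>u\<close> puts it to the right of the tile that the induction
  adds next, and the comparison with \<open>w\<close> keeps it in the polygon.\<close>

definition avoiding_tile :: "nat \<Rightarrow> (nat \<Rightarrow> nat) \<Rightarrow> (nat \<Rightarrow> nat) \<Rightarrow> complex set \<Rightarrow> bool" where
  "avoiding_tile k u w S \<longleftrightarrow> (\<exists>v j. v permutes {1..n} \<and> weak_le n u v \<and> Suc j < n \<and>
     v (Suc j) < v (Suc (Suc j)) \<and> weak_le n (swap_at (Suc j) v) w \<and> avoiding k v (Suc j) \<and> S = tile v j)"

lemma avoiding_tileE:
  assumes "avoiding_tile k u w S"
  obtains v j where "v permutes {1..n}" "weak_le n u v" "Suc j < n" "v (Suc j) < v (Suc (Suc j))"
    "weak_le n (swap_at (Suc j) v) w" "avoiding k v (Suc j)" "S = tile v j"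
  using assms unfolding avoiding_tile_def by (elim exE conjE)

text \<open>The tile of an avoiding swap is put to the left of a tiling of what remains. Covering is
  claimed only at depths where the two paths are apart, because at a pinch no tile has to contain
  the point.\<close>

lemma exists_avoiding_tiles:
  assumes w: "w permutes {1..n}" and k: "1 \<le> k" "k < n"
    and bad: "\<not> (inv w (Suc k) < inv w k \<and> \<not> together_in_321 n w k (Suc k))"
    and u: "u permutes {1..n}" and uw: "weak_le n u w"
  shows "\<exists>T. finite T \<and>
    (\<forall>S\<in>T. avoiding_tile k u w S) \<and>
    pairwise (\<lambda>R S. interior R \<inter> interior S = {}) T \<and>
    (\<forall>R\<in>T. \<forall>S\<in>T. (R \<inter> S) face_of R \<and> (R \<inter> S) face_of S) \<and>
    (\<forall>z. 0 \<le> depth z \<and> depth z \<le> total \<and> path_x u (depth z) \<le> Re z \<and> Re z \<le> path_x w (depth z) \<and>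
      path_x u (depth z) < path_x w (depth z) \<longrightarrow> z \<in> \<Union>T)"
  using u uw
proof (induction "card (missing n u w)" arbitrary: u rule: less_induct)
  case less
  note u = less.prems(1) and uw = less.prems(2)
  show ?case
  proof (cases "u = w")
    case True
    then show ?thesis by (intro exI[of _ "{}"]) auto
  next
    case False
    obtain i where i: "1 \<le> i" "i < n" "u i < u (Suc i)" "inv w (u (Suc i)) < inv w (u i)" "avoiding k u i"
      using exists_avoiding_swap[OF u w uw False k bad] by blast
    define j where "j = i - 1"
    have ij: "i = Suc j" using i by (simp add: j_def)
    note j = i[unfolded ij]
    define v where "v = swap_at (Suc j) u"
    have v: "v permutes {1..n}" using swap_at_permutes[OF u j(1,2)] by (simp add: v_def)
    have uv: "weak_le n u v" using weak_le_swap_at[OF u j(1-3)] by (simp add: v_def)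
    have vw: "weak_le n v w" using swap_at_weak_le[OF u uw j(4)] by (simp add: v_def)
    have lt: "card (missing n v w) < card (missing n u w)"
      using card_missing_swap_at[OF u j(1-4)] by (simp add: v_def)
    obtain T where T: "finite T"
      "\<forall>S\<in>T. avoiding_tile k v w S"
      "pairwise (\<lambda>R S. interior R \<inter> interior S = {}) T"
      "\<forall>R\<in>T. \<forall>S\<in>T. (R \<inter> S) face_of R \<and> (R \<inter> S) face_of S"
      "\<forall>z. 0 \<le> depth z \<and> depth z \<le> total \<and> path_x v (depth z) \<le> Re z \<and> Re z \<le> path_x w (depth z) \<and>
        path_x v (depth z) < path_x w (depth z) \<longrightarrow> z \<in> \<Union>T"
      using less.hyps[OF lt v vw] by blast
    note mem = tile_iff[OF u j(2,3), folded v_def]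
    \<comment> \<open>The new tile lies to the left of the path of \<open>v\<close>, all others to
      its right.\<close>
    have new: "interior (tile u j) \<inter> interior S = {} \<and>
      (tile u j \<inter> S) face_of tile u j \<and> (tile u j \<inter> S) face_of S" if "S \<in> T" for S
    proof -
      obtain x m where x: "x permutes {1..n}" "weak_le n v x" "Suc m < n" "x (Suc m) < x (Suc (Suc m))" "S = tile x m"
        using avoiding_tileE[of k v w S] T(2) \<open>S \<in> T\<close> by metis
      have "interior (tile u j) \<inter> interior S = {}"
      proof (rule ccontr)
        assume "\<not> ?thesis"
        then obtain z where z: "z \<in> interior (tile u j)" "z \<in> interior S" by blast
        have "Re z < path_x v (depth z)"
          using z(1) mem by (intro interior_left_of_path[of "tile u j"]) auto
        moreover have "path_x x (depth z) < Re z"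
          using z(2) tile_iff[OF x(1,3,4)] x(5) by (intro interior_right_of_path[of S]) auto
        moreover have "z \<in> tile u j" using z(1) interior_subset by blast
        then have "0 \<le> depth z" "depth z \<le> total"
          using mem[of z] level_mono[OF u, of 0 j] level_mono[OF u, of "Suc (Suc j)" n] level_n[OF u] j by auto
        ultimately show False using path_x_weak_le(1)[OF v x(1,2), of "depth z"] j by simp
      qed
      then show ?thesis
        using tiles_meet_in_faces[OF u j(2,3) x(1,3,4)] x(2,5) by (simp add: v_def)
    qed
    have self: "(tile u j \<inter> tile u j) face_of tile u j"
      by (simp add: face_of_refl tile_closed_convex)
    show ?thesis
    proof (intro exI[of _ "insert (tile u j) T"] conjI)
      show "finite (insert (tile u j) T)" using T(1) by simp
      have "avoiding_tile k u w (tile u j)"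
        unfolding avoiding_tile_def using u weak_le_refl j(2,3,5) vw v_def by blast
      moreover have "avoiding_tile k u w S" if "avoiding_tile k v w S" for S
        using that
      proof (rule avoiding_tileE)
        fix x m assume "x permutes {1..n}" "weak_le n v x" "Suc m < n" "x (Suc m) < x (Suc (Suc m))"
          "weak_le n (swap_at (Suc m) x) w" "avoiding k x (Suc m)" "S = tile x m"
        then show "avoiding_tile k u w S"
          unfolding avoiding_tile_def using weak_le_trans[OF uv, of x]
          by (intro exI[of _ x] exI[of _ m]) simp
      qed
      ultimately show "\<forall>S\<in>insert (tile u j) T. avoiding_tile k u w S" using T(2) by simp
      show "pairwise (\<lambda>R S. interior R \<inter> interior S = {}) (insert (tile u j) T)"
        unfolding pairwise_insert using new T(3) by (simp add: Int_commute)
      show "\<forall>R\<in>insert (tile u j) T. \<forall>S\<in>insert (tile u j) T. (R \<inter> S) face_of R \<and> (R \<inter> S) face_of S"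
        using new self T(4) by (simp add: Int_commute)
      show "\<forall>z. 0 \<le> depth z \<and> depth z \<le> total \<and> path_x u (depth z) \<le> Re z \<and> Re z \<le> path_x w (depth z) \<and>
        path_x u (depth z) < path_x w (depth z) \<longrightarrow> z \<in> \<Union>(insert (tile u j) T)"
      proof (intro allI impI)
        fix z
        assume z: "0 \<le> depth z \<and> depth z \<le> total \<and> path_x u (depth z) \<le> Re z \<and> Re z \<le> path_x w (depth z) \<and>
          path_x u (depth z) < path_x w (depth z)"
        show "z \<in> \<Union>(insert (tile u j) T)"
        proof (cases "path_x v (depth z) \<le> Re z \<and> path_x v (depth z) < path_x w (depth z)")
          case True
          then show ?thesis using T(5) z by blast
        next
          \<comment> \<open>The point is not beyond the path of \<open>v\<close>, and at this depth
            the swap really moves the path, so the depth is one of the new tile.\<close>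
          case False
          then have "path_x u (depth z) < path_x v (depth z)" "Re z \<le> path_x v (depth z)"
            using z by auto
          moreover from this have "level u j \<le> depth z \<and> depth z \<le> level u (Suc (Suc j))"
            using path_x_swap_at_outside[OF u j(2), of "depth z"] z by (fastforce simp: v_def)
          ultimately have "z \<in> tile u j" using mem z by blast
          then show ?thesis by simp
        qed
      qed
    qed
  qed
qed

lemma open_edge:
  assumes u: "u permutes {1..n}" and i: "i < n" and z: "z \<in> open_segment (vertex u i) (vertex u (Suc i))"
  shows "level u i < depth z" "depth z < level u (Suc i)" "Re z = path_x u (depth z)"
proof -
  have "z \<in> path_edge \<theta> u (Suc i)" "z \<noteq> vertex u i" "z \<noteq> vertex u (Suc i)"
    using z by (auto simp: path_edge_Suc open_segment_def)
  then have e: "level u i \<le> depth z" "depth z \<le> level u (Suc i)" "Re z = path_x u (depth z)"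
    using path_edge_iff[OF u i] by auto
  moreover have "depth z \<noteq> level u i" "depth z \<noteq> level u (Suc i)"
    using vertex_eqI[OF u, of i z] vertex_eqI[OF u, of "Suc i" z] e(3) i \<open>z \<noteq> vertex u i\<close> \<open>z \<noteq> vertex u (Suc i)\<close>
    by auto
  ultimately show "level u i < depth z" "depth z < level u (Suc i)" "Re z = path_x u (depth z)" by auto
qed

lemma vertex_neq:
  assumes u: "u permutes {1..n}" and i: "i < n"
  shows "vertex u i \<noteq> vertex u (Suc i)"
proof
  assume "vertex u i = vertex u (Suc i)"
  then have "depth (vertex u i) = depth (vertex u (Suc i))" by simp
  then show False using level_less[OF u, of i "Suc i"] i by simp
qed

text \<open>Top and bottom, where the covering by tiles says nothing, are reached as limits along
  the edges.\<close>

lemma edge_in_closed: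
  assumes u: "u permutes {1..n}" and i: "i < n" and "closed S"
    and "\<And>z. 0 < depth z \<Longrightarrow> depth z < total \<Longrightarrow> Re z = path_x u (depth z) \<Longrightarrow> z \<in> S"
  shows "path_edge \<theta> u (Suc i) \<subseteq> S"
proof -
  have "open_segment (vertex u i) (vertex u (Suc i)) \<subseteq> S"
  proof
    fix z assume "z \<in> open_segment (vertex u i) (vertex u (Suc i))"
    note e = open_edge[OF u i this]
    show "z \<in> S"
      using e assms(4) level_mono[OF u, of 0 i] level_mono[OF u, of "Suc i" n] i level_n[OF u] by auto
  qed
  then have "closure (open_segment (vertex u i) (vertex u (Suc i))) \<subseteq> S"
    using \<open>closed S\<close> closure_minimal by blast
  then show ?thesis using vertex_neq[OF u i] by (simp add: path_edge_Suc)
qed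

text \<open>The tile lies to the right of \<open>v\<close>, which lies to the right of the leftside
  boundary; a boundary edge inside the tile therefore belongs to the path of \<open>v\<close> as
  well.\<close>

lemma edge_in_tile:
  assumes v: "v permutes {1..n}" and j: "Suc j < n" and asc: "v (Suc j) < v (Suc (Suc j))"
    and i: "i < n" and sub: "path_edge \<theta> id (Suc i) \<subseteq> tile v j"
  shows "(i = j \<or> i = Suc j) \<and> v ` {1..i} = {1..i} \<and> v (Suc i) = Suc i"
proof -
  note id = permutes_id[of "{1..n}"]
  \<comment> \<open>An inner point of the edge, so that the two paths share not only the vertex
    above it but also the label of the edge.\<close>
  define z where "z = midpoint (vertex id i) (vertex id (Suc i))"
  have z: "z \<in> open_segment (vertex id i) (vertex id (Suc i))"
    using vertex_neq[OF id i] by (simp add: z_def)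
  note e = open_edge[OF id i z]
  define y where "y = depth z"
  have "z \<in> tile v j" using sub z by (auto simp: path_edge_Suc open_segment_def)
  then have t: "level v j \<le> y" "y \<le> level v (Suc (Suc j))" "path_x v y \<le> Re z"
    using tile_iff[OF v j asc, of z] by (auto simp: y_def)
  have y: "0 \<le> y" "y \<le> total"
    using t level_mono[OF v, of 0 j] level_mono[OF v, of "Suc (Suc j)" n] j level_n[OF v] by auto
  note cmp = path_x_weak_le[OF id v weak_le_id y]
  have "path_x id y = path_x v y" using cmp(1) t(3) e(3) j by (auto simp: y_def)
  then have "\<forall>l\<in>{1..n}. share id l y = share v l y" using cmp(2) j by simp
  note cp = common_prefix[OF id v this i, folded y_def]
  have ly: "level id i \<le> y" "y < level id (Suc i)" "level id i < y" using e by (auto simp: y_def)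
  note cp = cp[OF ly(1,2)]
  have "j \<le> i" using level_mono[OF v, of "Suc i" j] cp(5) t(1) j by force
  moreover have "i \<le> Suc j"
    using level_mono[OF v, of "Suc (Suc j)" i] cp(2) t(2) i ly(3) by force
  ultimately show ?thesis using cp(1) cp(4)[OF ly(3)] by auto
qed

text \<open>Two consecutive boundary edges in the tile must be its two left edges, so before them
  \<open>v\<close> has used an initial interval of labels: exactly the swap that
  \<open>avoiding\<close> excludes.\<close>

lemma avoiding_not_left_perimeter:
  assumes v: "v permutes {1..n}" and j: "Suc j < n" and asc: "v (Suc j) < v (Suc (Suc j))"
    and k: "k < n" and lab: "tile_with_labels n \<theta> k (Suc k) (tile v j)" and left: "left_perimeter_tile n \<theta> (tile v j)"
  shows "\<not> avoiding k v (Suc j)"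
proof -
  obtain p where kk: "k \<in> {1..n}" "Suc k \<in> {1..n}" and p: "tile v j = rhombus \<theta> p k (Suc k)"
    using lab by (auto simp: tile_with_labels_def)
  have "v (Suc j) \<in> {1..n}" "v (Suc (Suc j)) \<in> {1..n}" using permutes_label[OF v] j by simp_all
  note labels = rhombus_labels_unique[OF this asc kk lessI p[unfolded tile_def]]
  obtain m where m: "1 \<le> m" "m < n" "path_edge \<theta> id m edge_of tile v j" "path_edge \<theta> id (m + 1) edge_of tile v j"
    using left by (auto simp: left_perimeter_tile_def)
  define i where "i = m - 1"
  have mi: "m = Suc i" using m by (simp add: i_def)
  have "path_edge \<theta> id (Suc i) \<subseteq> tile v j" "path_edge \<theta> id (Suc (Suc i)) \<subseteq> tile v j"
    using m(3,4) mi by (auto simp: edge_of_def dest: face_of_imp_subset)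
  then have e: "(i = j \<or> i = Suc j) \<and> v ` {1..i} = {1..i} \<and> v (Suc i) = Suc i"
    "(Suc i = j \<or> Suc i = Suc j) \<and> v ` {1..Suc i} = {1..Suc i} \<and> v (Suc (Suc i)) = Suc (Suc i)"
    using edge_in_tile[OF v j asc] m(2) mi by auto
  then have "i = j" by auto
  then have "k = Suc j" using e(1) labels by simp
  then show ?thesis using e(1) labels \<open>i = j\<close> by (simp add: avoiding_def atLeastLessThanSuc_atLeastAtMost)
qed

lemma forced_imp_inverted_avoiding_321:
  assumes w: "w permutes {1..n}" and fs: "fully_supported n w" and k: "1 \<le> k" "k < n"
    and forced: "forced_left_perimeter_tile n \<theta> w k (Suc k)"
  shows "inv w (Suc k) < inv w k \<and> \<not> together_in_321 n w k (Suc k)"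
proof (rule ccontr)
  assume bad: "\<not> ?thesis"
  note id = permutes_id[of "{1..n}"]
  have n: "2 \<le> n" "0 < n" using k by auto
  obtain T where T: "finite T"
    "\<forall>S\<in>T. avoiding_tile k id w S"
    "pairwise (\<lambda>R S. interior R \<inter> interior S = {}) T"
    "\<forall>R\<in>T. \<forall>S\<in>T. (R \<inter> S) face_of R \<and> (R \<inter> S) face_of S"
    "\<forall>z. 0 \<le> depth z \<and> depth z \<le> total \<and> path_x id (depth z) \<le> Re z \<and> Re z \<le> path_x w (depth z) \<and>
      path_x id (depth z) < path_x w (depth z) \<longrightarrow> z \<in> \<Union>T"
    using exists_avoiding_tiles[OF w k bad id weak_le_id] by blast
  have "S \<subseteq> region id w \<and> (\<exists>i j. tile_with_labels n \<theta> i j S) \<and> closed S" if "S \<in> T" for S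
  proof -
    obtain x m where x: "x permutes {1..n}" "Suc m < n" "x (Suc m) < x (Suc (Suc m))"
      "weak_le n (swap_at (Suc m) x) w" "S = tile x m"
      using avoiding_tileE[of k id w S] T(2) \<open>S \<in> T\<close> by metis
    have sx: "swap_at (Suc m) x permutes {1..n}" using swap_at_permutes[OF x(1)] x(2) by simp
    have "z \<in> region id w" if "z \<in> S" for z
    proof -
      have z: "level x m \<le> depth z" "depth z \<le> level x (Suc (Suc m))"
        "path_x x (depth z) \<le> Re z" "Re z \<le> path_x (swap_at (Suc m) x) (depth z)"
        using that tile_iff[OF x(1-3)] x(5) by auto
      then have "0 \<le> depth z" "depth z \<le> total"
        using level_mono[OF x(1), of 0 m] level_mono[OF x(1), of "Suc (Suc m)" n] level_n[OF x(1)] x(2) by auto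
      moreover from this have "path_x id (depth z) \<le> path_x x (depth z)"
        "path_x (swap_at (Suc m) x) (depth z) \<le> path_x w (depth z)"
        using path_x_weak_le(1)[OF id x(1) weak_le_id] path_x_weak_le(1)[OF sx w x(4)] n by auto
      ultimately show ?thesis using z by (simp add: region_def)
    qed
    moreover have "tile_with_labels n \<theta> (x (Suc m)) (x (Suc (Suc m))) S"
      using permutes_label[OF x(1)] x(2,3,5) unfolding tile_with_labels_def tile_def by auto
    ultimately show ?thesis using x(5) tile_closed_convex by blast
  qed
  then have S: "\<And>S. S \<in> T \<Longrightarrow> S \<subseteq> region id w" "\<And>S. S \<in> T \<Longrightarrow> \<exists>i j. tile_with_labels n \<theta> i j S"
    "closed (\<Union>T)" using T(1) by (auto intro: closed_Union)
  have strict: "path_x id y < path_x w y" if "0 < y" "y < total" for y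
    by (rule fully_supported_strict[OF w fs n(1) that])
  have inner: "z \<in> \<Union>T" if "0 < depth z" "depth z < total" "path_x id (depth z) \<le> Re z" "Re z \<le> path_x w (depth z)" for z
    using T(5) that strict by simp
  have edges: "path_edge \<theta> id (Suc i) \<subseteq> \<Union>T" if "i < n" for i
  proof (rule edge_in_closed[OF id that S(3)])
    fix z assume "0 < depth z" "depth z < total" "Re z = path_x id (depth z)"
    then show "z \<in> \<Union>T" using inner[of z] strict[of "depth z"] by simp
  qed
  have "region id w \<subseteq> \<Union>T"
  proof
    fix z assume z: "z \<in> region id w"
    show "z \<in> \<Union>T"
    proof (cases "0 < depth z \<and> depth z < total")
      case True
      then show ?thesis using inner z by (auto simp: region_def)
    next
      \<comment> \<open>Here the two paths coincide, so the point lies on the leftside boundary,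
        whose edges are covered.\<close>
      case False
      then have d: "depth z = 0 \<or> depth z = total" using z by (auto simp: region_def)
      then have "path_x id (depth z) = path_x w (depth z)" using path_x_ends[OF id w n(2)] by auto
      then have x: "Re z = path_x id (depth z)" using z by (auto simp: region_def)
      obtain i where "i < n" "level id i \<le> depth z" "depth z \<le> level id (Suc i)"
        using exists_edge_closed[OF id _ _ n(2), of "depth z"] z by (auto simp: region_def)
      then have "z \<in> path_edge \<theta> id (Suc i)" using path_edge_iff[OF id] x by simp
      then show ?thesis using edges[OF \<open>i < n\<close>] by blast
    qed
  qed
  then have "\<Union>T = elnitsky_polygon n \<theta> w"
    using S(1) elnitsky_polygon_region[OF w fs n(1)] by blast
  then have "T \<in> rhombic_tilings n \<theta> w"
    using T S(2) by (simp add: rhombic_tilings_def)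
  then obtain R where R: "R \<in> T" "tile_with_labels n \<theta> k (Suc k) R" "left_perimeter_tile n \<theta> R"
    using forced by (auto simp: forced_left_perimeter_tile_def)
  then obtain x m where "x permutes {1..n}" "Suc m < n" "x (Suc m) < x (Suc (Suc m))"
      "avoiding k x (Suc m)" "R = tile x m"
    using avoiding_tileE[of k id w R] T(2) by metis
  then show False using avoiding_not_left_perimeter k(2) R by blast
qed

end

subsection \<open>Dismantling a tiling from the left\<close>

text \<open>Pigeonhole: if \<open>P\<close> failed for every tile at all small \<open>t\<close>, the
  finitely many thresholds would have a common one.\<close>

lemma finite_tiles_frequently:
  assumes "finite T" and "\<And>t. 0 < t \<Longrightarrow> t < t0 \<Longrightarrow> \<exists>S\<in>T. P t S" and "(0::real) < t0"
  shows "\<exists>S\<in>T. \<forall>e>0. \<exists>t. 0 < t \<and> t < e \<and> P t S"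
proof (rule ccontr)
  assume "\<not> ?thesis"
  then have "\<forall>S\<in>T. eventually (\<lambda>t. \<not> P t S) (at_right 0)"
    unfolding eventually_at_right_field by blast
  then have "eventually (\<lambda>t. \<forall>S\<in>T. \<not> P t S) (at_right 0)"
    using assms(1) by (simp add: eventually_ball_finite)
  moreover have "eventually (\<lambda>t. \<exists>S\<in>T. P t S) (at_right 0)"
    unfolding eventually_at_right_field using assms(2,3) by blast
  ultimately have "eventually (\<lambda>t::real. False) (at_right 0)"
    by eventually_elim auto
  then show False by simp
qed

context angles
begin

text \<open>What remains of a tiling after tiles have been removed from the left. Only an inequality
  between the paths is recorded, as the weak order is to be derived from it, and the covering
  concerns only points strictly between the paths, as the region may be pinched.\<close>

definition partial_tiling :: "(nat \<Rightarrow> nat) \<Rightarrow> (nat \<Rightarrow> nat) \<Rightarrow> complex set set \<Rightarrow> bool" where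
  "partial_tiling u w T \<longleftrightarrow> finite T \<and>
     (\<forall>R\<in>T. \<exists>p. \<exists>a\<in>{1..n}. \<exists>b\<in>{1..n}. a < b \<and> R = rhombus \<theta> p a b) \<and>
     pairwise (\<lambda>R S. interior R \<inter> interior S = {}) T \<and>
     (\<forall>R\<in>T. \<forall>S\<in>T. (R \<inter> S) face_of R \<and> (R \<inter> S) face_of S) \<and>
     (\<forall>R\<in>T. R \<subseteq> region u w) \<and>
     {z. 0 \<le> depth z \<and> depth z \<le> total \<and> path_x u (depth z) < Re z \<and> Re z < path_x w (depth z)} \<subseteq> \<Union>T \<and>
     (\<forall>y. 0 \<le> y \<and> y \<le> total \<longrightarrow> path_x u y \<le> path_x w y)"

lemma partial_tilingD:
  assumes "partial_tiling u w T"
  shows "finite T"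
    and "R \<in> T \<Longrightarrow> \<exists>p. \<exists>a\<in>{1..n}. \<exists>b\<in>{1..n}. a < b \<and> R = rhombus \<theta> p a b"
    and "R \<in> T \<Longrightarrow> S \<in> T \<Longrightarrow> R \<noteq> S \<Longrightarrow> interior R \<inter> interior S = {}"
    and "R \<in> T \<Longrightarrow> S \<in> T \<Longrightarrow> (R \<inter> S) face_of R \<and> (R \<inter> S) face_of S"
    and "R \<in> T \<Longrightarrow> z \<in> R \<Longrightarrow> 0 \<le> depth z \<and> depth z \<le> total \<and>
      path_x u (depth z) \<le> Re z \<and> Re z \<le> path_x w (depth z)"
    and "0 \<le> depth z \<Longrightarrow> depth z \<le> total \<Longrightarrow> path_x u (depth z) < Re z \<Longrightarrow> Re z < path_x w (depth z) \<Longrightarrow> \<exists>R\<in>T. z \<in> R"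
    and "0 \<le> y \<Longrightarrow> y \<le> total \<Longrightarrow> path_x u y \<le> path_x w y"
proof -
  show "finite T" "R \<in> T \<Longrightarrow> \<exists>p. \<exists>a\<in>{1..n}. \<exists>b\<in>{1..n}. a < b \<and> R = rhombus \<theta> p a b"
    "R \<in> T \<Longrightarrow> S \<in> T \<Longrightarrow> (R \<inter> S) face_of R \<and> (R \<inter> S) face_of S"
    "0 \<le> y \<Longrightarrow> y \<le> total \<Longrightarrow> path_x u y \<le> path_x w y"
    using assms unfolding partial_tiling_def by auto
  show "R \<in> T \<Longrightarrow> S \<in> T \<Longrightarrow> R \<noteq> S \<Longrightarrow> interior R \<inter> interior S = {}"
    using assms unfolding partial_tiling_def pairwise_def by blast
  show "R \<in> T \<Longrightarrow> z \<in> R \<Longrightarrow> 0 \<le> depth z \<and> depth z \<le> total \<and>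
      path_x u (depth z) \<le> Re z \<and> Re z \<le> path_x w (depth z)"
    using assms unfolding partial_tiling_def region_def by blast
  show "0 \<le> depth z \<Longrightarrow> depth z \<le> total \<Longrightarrow> path_x u (depth z) < Re z \<Longrightarrow> Re z < path_x w (depth z) \<Longrightarrow> \<exists>R\<in>T. z \<in> R"
    using assms unfolding partial_tiling_def by blast
qed

section \<open>Interior points and horizontal moves in a rhombus\<close>

lemma rhombus_interiorI:
  assumes a: "a \<in> {1..n}" and b: "b \<in> {1..n}" and ab: "a < b"
    and ST: "0 < S" "S < height a" "0 < T" "T < height b"
    and z: "depth z - depth p = S + T" "Re z - Re p = slope a * S + slope b * T"
  shows "z \<in> interior (rhombus \<theta> p a b)"
proof -
  define \<Delta> where "\<Delta> = slope b - slope a"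
  have \<Delta>: "0 < \<Delta>" using slope_less[OF a b ab] by (simp add: \<Delta>_def)
  define t where "t = (\<lambda>z. (Re z - Re p - slope a * (depth z - depth p)) / \<Delta>)"
  define s where "s = (\<lambda>z. depth z - depth p - t z)"
  define U where "U = {z. 0 < s z \<and> s z < height a \<and> 0 < t z \<and> t z < height b}"
  have "open U" unfolding U_def s_def t_def
    using \<Delta> by (intro open_Collect_conj open_Collect_less continuous_intros) auto
  moreover have "U \<subseteq> rhombus \<theta> p a b"
  proof
    fix z assume z: "z \<in> U"
    have "slope a * s z + slope b * t z = slope a * (depth z - depth p) + \<Delta> * t z"
      by (simp add: s_def \<Delta>_def algebra_simps)
    also have "\<dots> = Re z - Re p" using \<Delta> by (simp add: t_def)
    finally show "z \<in> rhombus \<theta> p a b"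
      unfolding rhombus_coordinates[OF a b] using z
      by (intro exI[of _ "s z"] exI[of _ "t z"]) (auto simp: U_def s_def)
  qed
  moreover have "z \<in> U"
  proof -
    have "Re z - Re p - slope a * (depth z - depth p) = \<Delta> * T"
      unfolding z by (simp add: \<Delta>_def algebra_simps)
    then have "t z = T" using \<Delta> by (simp add: t_def)
    then show ?thesis using ST z by (simp add: U_def s_def)
  qed
  ultimately show ?thesis using interior_maximal by blast
qed

lemma rhombus_interior_nonempty:
  assumes a: "a \<in> {1..n}" and b: "b \<in> {1..n}" and ab: "a < b"
  shows "interior (rhombus \<theta> p a b) \<noteq> {}"
proof -
  define S where "S = height a / 2"
  define T where "T = height b / 2"
  define z where "z = p + Complex (slope a * S + slope b * T) (- (S + T))"
  have "z \<in> interior (rhombus \<theta> p a b)"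
    using height_pos[OF a] height_pos[OF b]
    by (intro rhombus_interiorI[OF a b ab, of S T]) (simp_all add: S_def T_def z_def)
  then show ?thesis by blast
qed

lemma left_corner_interior:
  assumes a: "a \<in> {1..n}" and b: "b \<in> {1..n}" and ab: "a < b"
  obtains e where "0 < e" "\<And>r. 0 < r \<Longrightarrow> r < e \<Longrightarrow> p + cis (\<theta> a) + of_real r \<in> interior (rhombus \<theta> p a b)"
proof -
  define \<Delta> where "\<Delta> = slope b - slope a"
  have \<Delta>: "0 < \<Delta>" using slope_less[OF a b ab] by (simp add: \<Delta>_def)
  \<comment> \<open>Moving right by \<open>r\<close> from the left corner trades
    \<open>r / \<Delta>\<close> of the coordinate along \<open>a\<close> for the same amount along
    \<open>b\<close>; this stays inside while the amount is less than both heights.\<close>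
  define e where "e = \<Delta> * min (height a) (height b)"
  have h: "0 < height a" "0 < height b" using height_pos a b by auto
  have "0 < e" using \<Delta> h by (simp add: e_def)
  moreover have "p + cis (\<theta> a) + of_real r \<in> interior (rhombus \<theta> p a b)" if r: "0 < r" "r < e" for r
  proof -
    define T where "T = r / \<Delta>"
    have rT: "r = slope b * T - slope a * T"
    proof -
      have "\<Delta> * T = r" using \<Delta> by (simp add: T_def)
      then show ?thesis by (simp add: \<Delta>_def algebra_simps)
    qed
    have "0 < T" "T < min (height a) (height b)"
      using r \<Delta> by (simp_all add: T_def e_def pos_divide_less_eq mult.commute del: min_less_iff_conj)
    then show ?thesis
      using Re_cis_slope[OF a]
      by (intro rhombus_interiorI[OF a b ab, of "height a - T" T])
        (simp_all add: rT algebra_simps del: cis.sel of_real_diff of_real_mult)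
  qed
  ultimately show ?thesis using that by blast
qed

text \<open>Trading an amount \<open>\<sigma>\<close> of one coordinate for the other keeps the
  depth and moves the point horizontally by \<open>\<sigma>\<close> times the difference of the
  slopes.\<close>

lemma rhombus_move:
  assumes a: "a \<in> {1..n}" and b: "b \<in> {1..n}" and ab: "a < b"
    and ST: "0 \<le> S" "S \<le> height a" "0 \<le> T" "T \<le> height b"
    and q: "depth q - depth p = S + T" "Re q - Re p = slope a * S + slope b * T"
  shows "0 < S \<Longrightarrow> T < height b \<Longrightarrow> \<exists>r>0. q + of_real r \<in> rhombus \<theta> p a b"
    and "S < height a \<Longrightarrow> 0 < T \<Longrightarrow> \<exists>r>0. q - of_real r \<in> rhombus \<theta> p a b"
proof -
  define \<Delta> where "\<Delta> = slope b - slope a"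
  have \<Delta>: "0 < \<Delta>" using slope_less[OF a b ab] by (simp add: \<Delta>_def)
  show "\<exists>r>0. q + of_real r \<in> rhombus \<theta> p a b" if "0 < S" "T < height b"
  proof -
    define \<sigma> where "\<sigma> = min S (height b - T)"
    have \<sigma>: "0 < \<sigma>" "\<sigma> \<le> S" "\<sigma> \<le> height b - T" using that by (auto simp: \<sigma>_def)
    define r where "r = \<Delta> * \<sigma>"
    have r: "0 < r" "r = slope b * \<sigma> - slope a * \<sigma>"
      using \<sigma>(1) \<Delta> by (simp_all add: r_def \<Delta>_def algebra_simps)
    have "depth (q + of_real r) - depth p = (S - \<sigma>) + (T + \<sigma>)" using q(1) by simp
    moreover have "Re (q + of_real r) - Re p = slope a * (S - \<sigma>) + slope b * (T + \<sigma>)"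
      using q(2) r(2) by (simp add: algebra_simps)
    moreover have "0 \<le> S - \<sigma>" "S - \<sigma> \<le> height a" "0 \<le> T + \<sigma>" "T + \<sigma> \<le> height b" using ST \<sigma> by auto
    ultimately have "q + of_real r \<in> rhombus \<theta> p a b"
      unfolding rhombus_coordinates[OF a b] by blast
    then show ?thesis using r(1) by blast
  qed
  show "\<exists>r>0. q - of_real r \<in> rhombus \<theta> p a b" if "S < height a" "0 < T"
  proof -
    define \<sigma> where "\<sigma> = min T (height a - S)"
    have \<sigma>: "0 < \<sigma>" "\<sigma> \<le> T" "\<sigma> \<le> height a - S" using that by (auto simp: \<sigma>_def)
    define r where "r = \<Delta> * \<sigma>"
    have r: "0 < r" "r = slope b * \<sigma> - slope a * \<sigma>"
      using \<sigma>(1) \<Delta> by (simp_all add: r_def \<Delta>_def algebra_simps)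
    have "depth (q - of_real r) - depth p = (S + \<sigma>) + (T - \<sigma>)" using q(1) by simp
    moreover have "Re (q - of_real r) - Re p = slope a * (S + \<sigma>) + slope b * (T - \<sigma>)"
      using q(2) r(2) by (simp add: algebra_simps)
    moreover have "0 \<le> S + \<sigma>" "S + \<sigma> \<le> height a" "0 \<le> T - \<sigma>" "T - \<sigma> \<le> height b" using ST \<sigma> by auto
    ultimately have "q - of_real r \<in> rhombus \<theta> p a b"
      unfolding rhombus_coordinates[OF a b] by blast
    then show ?thesis using r(1) by blast
  qed
qed

text \<open>
  The tile that contains the points just to the right of the \<open>i\<close>th edge near its upper endpoint \<open>q\<close>
  has \<open>q\<close> as a vertex; as it stays to the right of the path, \<open>q\<close> can only be its top.
\<close>

lemma corner_tile:
  assumes T: "partial_tiling u w T" and u: "u permutes {1..n}" and i: "i < n"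
    and q: "q = vertex u i"
    and gap: "0 < \<delta>" "\<And>y. level u i < y \<Longrightarrow> y < level u i + \<delta> \<Longrightarrow> path_x u y < path_x w y"
    and corner: "\<And>p a b. a \<in> {1..n} \<Longrightarrow> b \<in> {1..n} \<Longrightarrow> a < b \<Longrightarrow> rhombus \<theta> p a b \<in> T \<Longrightarrow> q \<in> rhombus \<theta> p a b \<Longrightarrow>
      q \<in> {p, p + cis (\<theta> a), p + cis (\<theta> b), p + cis (\<theta> a) + cis (\<theta> b)}"
    and left: "\<And>p a b. a \<in> {1..n} \<Longrightarrow> b \<in> {1..n} \<Longrightarrow> a < b \<Longrightarrow> rhombus \<theta> p a b \<in> T \<Longrightarrow> q = p + cis (\<theta> a) \<Longrightarrow>
      u (Suc i) < b"
  shows "\<exists>b\<in>{1..n}. u (Suc i) < b \<and> rhombus \<theta> q (u (Suc i)) b \<in> T"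
proof -
  define c where "c = u (Suc i)"
  have c: "c \<in> {1..n}" using permutes_label[OF u i] by (simp add: c_def)
  define h where "h = height c"
  have h: "0 < h" using height_pos[OF c] by (simp add: h_def)
  have dq: "depth q = level u i" by (simp add: q)
  have lev: "level u (Suc i) = level u i + h" by (simp add: level_Suc h_def c_def)
  have bounds: "0 \<le> level u i" "level u (Suc i) \<le> total"
    using level_mono[OF u, of 0 i] level_mono[OF u, of "Suc i" n] level_n[OF u] i by auto
  have pu: "path_x u (level u i + d) = Re q + slope c * d" if "0 \<le> d" "d \<le> h" for d
    using path_x_at[OF u i, of "level u i + d"] that lev by (simp add: q c_def)
  \<comment> \<open>The points \<open>x t\<close> run along the edge, moved to the right by
    \<open>\<epsilon> t\<close>: half the gap keeps them to the left of \<open>w\<close>, and the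
    quadratic bound makes them leave \<open>q\<close> in the direction of the edge.\<close>
  define \<epsilon> where "\<epsilon> t = min (t * t) ((path_x w (level u i + t * h) - path_x u (level u i + t * h)) / 2)" for t
  define x where "x t = q + t *\<^sub>R cis (\<theta> c) + of_real (\<epsilon> t)" for t
  define t0 where "t0 = min 1 (\<delta> / h)"
  have t0: "0 < t0" using h gap(1) by (simp add: t0_def)
  have dx: "depth (x t) - depth q = t * h" for t by (simp add: x_def h_def)
  have Rx: "Re (x t) - Re q = slope c * (t * h) + \<epsilon> t" for t
    using Re_cis_slope[OF c] by (simp add: x_def h_def del: cis.sel)
  have th: "0 < t * h" "t * h \<le> h" "t * h < \<delta>" if "0 < t" "t < t0" for t
    using that h by (auto simp: t0_def pos_less_divide_eq)
  have ep: "0 < \<epsilon> t" "\<epsilon> t \<le> t * t" if "0 < t" "t < t0" for t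
    using that gap(2)[of "level u i + t * h"] th[OF that] by (auto simp: \<epsilon>_def)
  have cover: "\<exists>S\<in>T. x t \<in> S" if t: "0 < t" "t < t0" for t
  proof -
    have d: "depth (x t) = level u i + t * h" using dx[of t] dq by simp
    have pw: "path_x u (depth (x t)) < path_x w (depth (x t))"
      using gap(2) th[OF t] d by simp
    have x: "Re (x t) = path_x u (depth (x t)) + \<epsilon> t"
      using Rx[of t] pu[of "t * h"] th[OF t] d by simp
    have "\<epsilon> t \<le> (path_x w (depth (x t)) - path_x u (depth (x t))) / 2"
      unfolding \<epsilon>_def d by (rule min.cobounded2)
    then have "Re (x t) < path_x w (depth (x t))" using x pw by simp
    moreover have "path_x u (depth (x t)) < Re (x t)" using x ep[OF t] by simp
    moreover have "0 \<le> depth (x t)" "depth (x t) \<le> total" using d th[OF t] bounds lev by auto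
    ultimately show ?thesis by (intro partial_tilingD(6)[OF T])
  qed
  obtain S where S: "S \<in> T" and freq0: "\<forall>e>0. \<exists>t. 0 < t \<and> t < e \<and> x t \<in> S"
    using finite_tiles_frequently[of T t0 "\<lambda>t S. x t \<in> S", OF partial_tilingD(1)[OF T] cover t0] by blast
  have freq: "\<exists>t. 0 < t \<and> t < e \<and> t < t0 \<and> x t \<in> S" if "0 < e" for e
    using freq0[rule_format, of "min e t0"] that t0 by auto
  obtain p a b where a: "a \<in> {1..n}" and b: "b \<in> {1..n}" and ab: "a < b" and Sr: "S = rhombus \<theta> p a b"
    using partial_tilingD(2)[OF T S] by blast
  have right: "path_x u (depth z) \<le> Re z" if "z \<in> S" for z
    using partial_tilingD(5)[OF T S that] by blast
  \<comment> \<open>The error \<open>\<epsilon> t \<le> t * t\<close>, divided by \<open>t\<close>,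
    vanishes along the points of \<open>S\<close> that approach \<open>q\<close>.\<close>
  have limit: "\<alpha> \<le> \<beta>" if "\<And>t. 0 < t \<Longrightarrow> t < t0 \<Longrightarrow> x t \<in> S \<Longrightarrow> \<alpha> * h \<le> \<beta> * h + t" for \<alpha> \<beta>
  proof (rule ccontr)
    assume "\<not> \<alpha> \<le> \<beta>"
    then have "0 < (\<alpha> - \<beta>) * h" using h by simp
    then obtain t where "0 < t" "t < (\<alpha> - \<beta>) * h" "t < t0" "x t \<in> S" using freq by blast
    then show False using that[of t] by (simp add: algebra_simps)
  qed
  have "q \<in> S"
  proof -
    have "\<exists>z\<in>S. dist z q < e" if e: "0 < e" for e
    proof -
      obtain t where t: "0 < t" "t < min (e/2) 1" "t < t0" "x t \<in> S" using freq[of "min (e/2) 1"] e by auto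
      have "dist (x t) q \<le> norm (t *\<^sub>R cis (\<theta> c)) + norm (complex_of_real (\<epsilon> t))"
        unfolding x_def dist_norm using norm_triangle_ineq[of "t *\<^sub>R cis (\<theta> c)" "complex_of_real (\<epsilon> t)"]
        by (simp add: algebra_simps)
      also have "\<dots> \<le> t + t * t" using t ep[of t] by simp
      also have "t * t \<le> t" using t by simp
      finally have "dist (x t) q < e" using t by simp
      then show ?thesis using t(4) by blast
    qed
    then show ?thesis using closed_approachable[of S q] closed_rhombus Sr by metis
  qed
  obtain t1 where t1: "0 < t1" "t1 < t0" "x t1 \<in> S" using freq[of 1] by auto
  have "q = p"
  proof (rule ccontr)
    assume "q \<noteq> p"
    then consider "q = p + cis (\<theta> a)" | "q = p + cis (\<theta> b)" | "q = p + cis (\<theta> a) + cis (\<theta> b)"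
      using corner[OF a b ab] S Sr \<open>q \<in> S\<close> by auto
    then show False
    proof cases
      \<comment> \<open>Below its left corner the tile stays to the right of the direction of
        \<open>b\<close>, but the edge labeled \<open>c\<close> runs to the left of this
        direction.\<close>
      case 1
      then have cb: "c < b" using left[OF a b ab] S Sr by (simp add: c_def)
      have "slope b \<le> slope c"
      proof (rule limit)
        fix t assume t: "0 < t" "t < t0" "x t \<in> S"
        then obtain s r where sr: "s \<le> height a" "depth (x t) - depth p = s + r" "Re (x t) - Re p = slope a * s + slope b * r"
          unfolding Sr rhombus_coordinates[OF a b] by blast
        have d: "t * h = s - height a + r" using sr(2) dx[of t] 1 by simp
        have r: "slope c * (t * h) + \<epsilon> t = slope a * (s - height a) + slope b * r"
          using sr(3) Rx[of t] 1 Re_cis_slope[OF a] by (simp add: algebra_simps del: cis.sel)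
        have "slope b * (s - height a) \<le> slope a * (s - height a)"
          using slope_less[OF a b ab] sr(1) by (intro mult_right_mono_neg) auto
        then have "slope b * (t * h) \<le> slope c * (t * h) + t * t"
        proof -
          have "slope b * (t * h) = slope b * (s - height a) + slope b * r"
            unfolding d by (simp add: algebra_simps)
          then show ?thesis using \<open>slope b * (s - height a) \<le> _\<close> r ep[OF t(1,2)] by linarith
        qed
        then have "t * (slope b * h) \<le> t * (slope c * h + t)" by (simp add: algebra_simps)
        then show "slope b * h \<le> slope c * h + t" using t by simp
      qed
      then show False using cb slope_le_iff[OF b c] by simp
    next
      \<comment> \<open>From the right corner one can move to the left inside the tile, across the
        path.\<close>
      case 2
      have "\<exists>r>0. q - of_real r \<in> S" unfolding Sr
        using rhombus_move(2)[OF a b ab, of 0 "height b" q p] height_pos[OF a] height_pos[OF b] 2 Re_cis_slope[OF b]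
        by (simp del: cis.sel)
      then obtain r where "0 < r" "q - of_real r \<in> S" by blast
      then show False using right[of "q - of_real r"] pu[of 0] h dq by simp
    next
      case 3
      obtain s r where "s \<le> height a" "r \<le> height b" "depth (x t1) - depth p = s + r"
        using t1(3) unfolding Sr rhombus_coordinates[OF a b] by blast
      then show False using dx[of t1] th[OF t1(1,2)] 3 by simp
    qed
  qed
  \<comment> \<open>From the top, \<open>a\<close> is the leftmost direction of the tile, and the
    points \<open>x t\<close> in it approach \<open>q\<close> in direction \<open>c\<close>.
    Conversely, the left edge of the tile may not cross the path.\<close>
  have "slope a \<le> slope c"
  proof (rule limit)
    fix t assume t: "0 < t" "t < t0" "x t \<in> S"
    then obtain s r where sr: "0 \<le> r" "depth (x t) - depth p = s + r" "Re (x t) - Re p = slope a * s + slope b * r"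
      unfolding Sr rhombus_coordinates[OF a b] by blast
    have "slope a * r \<le> slope b * r" using slope_less[OF a b ab] sr(1) by (intro mult_right_mono) auto
    then have "slope a * (t * h) \<le> slope c * (t * h) + t * t"
    proof -
      have "t * h = s + r" using sr(2) dx[of t] \<open>q = p\<close> by simp
      then have "slope a * (t * h) = slope a * s + slope a * r" by (simp add: distrib_left)
      then show ?thesis
        using \<open>slope a * r \<le> slope b * r\<close> sr(3) Rx[of t, unfolded \<open>q = p\<close>] ep[OF t(1,2)] by linarith
    qed
    then have "t * (slope a * h) \<le> t * (slope c * h + t)" by (simp add: algebra_simps)
    then show "slope a * h \<le> slope c * h + t" using t by simp
  qed
  moreover have "slope c \<le> slope a"
  proof -
    define s where "s = min h (height a)"
    have s: "0 < s" "s \<le> h" "s \<le> height a" using h height_pos[OF a] by (auto simp: s_def)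
    define z where "z = q + Complex (slope a * s) (- s)"
    have "z \<in> S" unfolding Sr rhombus_coordinates[OF a b] using s \<open>q = p\<close> height_pos[OF b]
      by (intro exI[of _ s] exI[of _ 0]) (simp add: z_def)
    then have "slope c * s \<le> slope a * s" using right[of z] pu[of s] s dq by (simp add: z_def)
    then show ?thesis using s by simp
  qed
  ultimately have "a = c" using slope_le_iff[OF a c] slope_le_iff[OF c a] by simp
  then show ?thesis using S Sr b ab \<open>q = p\<close> by (auto simp: c_def)
qed

text \<open>At the vertex where the two paths first part, the region has zero width, so no tile
  through this vertex allows a horizontal move there. All points of a rhombus but top and bottom
  allow one, so \<open>corner_tile\<close> applies.\<close>

lemma first_corner_tile:
  assumes T: "partial_tiling u w T" and u: "u permutes {1..n}" and w: "w permutes {1..n}" and ne: "u \<noteq> w"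
  shows "\<exists>i<n. \<exists>b\<in>{1..n}. u (Suc i) < b \<and> rhombus \<theta> (vertex u i) (u (Suc i)) b \<in> T"
proof -
  define i where "i = (LEAST i. u (Suc i) \<noteq> w (Suc i))"
  obtain l where l: "u l \<noteq> w l" using ne by blast
  then have ln: "l \<in> {1..n}" using permutes_not_in[OF u] permutes_not_in[OF w] by metis
  then have ex: "u (Suc (l - 1)) \<noteq> w (Suc (l - 1))" using l by simp
  have i_ne: "u (Suc i) \<noteq> w (Suc i)" unfolding i_def by (rule LeastI[of "\<lambda>i. u (Suc i) \<noteq> w (Suc i)", OF ex])
  have "i \<le> l - 1" unfolding i_def by (rule Least_le[of "\<lambda>i. u (Suc i) \<noteq> w (Suc i)", OF ex])
  then have i: "i < n" using ln by auto
  have before: "u k = w k" if "k \<in> {1..i}" for k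
    using not_less_Least[of "k - 1" "\<lambda>i. u (Suc i) \<noteq> w (Suc i)"] that by (auto simp: i_def)
  have lev: "level w i = level u i" and vert: "vertex w i = vertex u i"
    unfolding level_def path_vertex_def using before by (auto intro!: sum.cong)
  define q where "q = vertex u i"
  have dq: "depth q = level u i" by (simp add: q_def)
  have n: "0 < n" using i by simp
  have Rq: "Re q = path_x u (level u i)" "Re q = path_x w (level u i)"
    using path_x_vertex[OF u, of i] path_x_vertex[OF w, of i] i lev vert by (simp_all add: q_def)
  define c where "c = u (Suc i)"
  define e where "e = w (Suc i)"
  have ce: "c \<in> {1..n}" "e \<in> {1..n}" using permutes_label[OF u i] permutes_label[OF w i] by (simp_all add: c_def e_def)
  \<comment> \<open>Up to this depth below \<open>q\<close> both paths run along their first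
    differing edges.\<close>
  define \<delta> where "\<delta> = min (height c) (height e)"
  have \<delta>: "0 < \<delta>" using height_pos ce by (simp add: \<delta>_def)
  have pu: "path_x u (level u i + d) = Re q + slope c * d" if "0 \<le> d" "d \<le> \<delta>" for d
    using path_x_at[OF u i, of "level u i + d"] that by (simp add: q_def c_def \<delta>_def level_Suc)
  have pw: "path_x w (level u i + d) = Re q + slope e * d" if "0 \<le> d" "d \<le> \<delta>" for d
    using path_x_at[OF w i, of "level u i + d"] that by (simp add: q_def e_def \<delta>_def level_Suc lev vert)
  have "level u (Suc i) \<le> total" "0 \<le> level u i"
    using level_mono[OF u, of "Suc i" n] level_mono[OF u, of 0 i] level_n[OF u] i by auto
  then have "path_x u (level u i + \<delta>) \<le> path_x w (level u i + \<delta>)"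
    using \<delta> by (intro partial_tilingD(7)[OF T]) (auto simp: level_Suc \<delta>_def c_def)
  then have "slope c \<le> slope e" using pu[of \<delta>] pw[of \<delta>] \<delta> by simp
  moreover have "c \<noteq> e" using i_ne by (simp add: c_def e_def)
  ultimately have "slope c < slope e"
    using slope_less_iff[OF ce] slope_le_iff[OF ce] by simp
  have gap: "path_x u y < path_x w y" if "level u i < y" "y < level u i + \<delta>" for y
    using pu[of "y - level u i"] pw[of "y - level u i"] that \<open>slope c < slope e\<close> by simp
  have single: "r \<le> 0" if "S \<in> T" "q + of_real r \<in> S \<or> q - of_real r \<in> S" for r S
    using partial_tilingD(5)[OF T that(1), of "q + of_real r"] partial_tilingD(5)[OF T that(1), of "q - of_real r"]
      that(2) Rq dq by auto
  have move: "(s = 0 \<or> r = height b) \<and> (s = height a \<or> r = 0)"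
    if ab: "a \<in> {1..n}" "b \<in> {1..n}" "a < b" and S: "rhombus \<theta> p a b \<in> T"
      and sr: "0 \<le> s" "s \<le> height a" "0 \<le> r" "r \<le> height b"
        "depth q - depth p = s + r" "Re q - Re p = slope a * s + slope b * r" for p a b s r
  proof (rule ccontr)
    assume "\<not> ?thesis"
    then have "\<exists>r>0. q + of_real r \<in> rhombus \<theta> p a b \<or> q - of_real r \<in> rhombus \<theta> p a b"
      using rhombus_move[OF ab sr] sr(1-4) by (auto simp: less_le)
    then show False using single[OF S] by force
  qed
  have "\<exists>b\<in>{1..n}. u (Suc i) < b \<and> rhombus \<theta> q (u (Suc i)) b \<in> T"
  proof (rule corner_tile[OF T u i q_def \<delta> gap])
    fix p a b
    assume ab: "a \<in> {1..n}" "b \<in> {1..n}" "a < b" and S: "rhombus \<theta> p a b \<in> T"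
    note h = height_pos[OF ab(1)] height_pos[OF ab(2)]
    {
      assume "q \<in> rhombus \<theta> p a b"
      then obtain s r where sr: "0 \<le> s" "s \<le> height a" "0 \<le> r" "r \<le> height b"
        "depth q - depth p = s + r" "Re q - Re p = slope a * s + slope b * r"
        unfolding rhombus_coordinates[OF ab(1,2)] by blast
      then have "(s = 0 \<and> r = 0) \<or> (s = height a \<and> r = height b)"
        using move[OF ab S sr] h by auto
      then have "q = p \<or> q = p + cis (\<theta> a) + cis (\<theta> b)"
        using sr(5,6) Re_cis_slope[OF ab(1)] Re_cis_slope[OF ab(2)]
        unfolding complex_eq_depth by (auto simp del: cis.sel)
      then show "q \<in> {p, p + cis (\<theta> a), p + cis (\<theta> b), p + cis (\<theta> a) + cis (\<theta> b)}" by auto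
    }
    \<comment> \<open>Vacuous: a left corner would allow a move to the right.\<close>
    assume "q = p + cis (\<theta> a)"
    then have "(height a = 0 \<or> 0 = height b)"
      using move[OF ab S, of "height a" 0] h Re_cis_slope[OF ab(1)] by (simp del: cis.sel)
    then show "u (Suc i) < b" using h by simp
  qed
  then show ?thesis using i by (auto simp: q_def)
qed

text \<open>The next vertex \<open>q\<close> is the left corner of the given tile. From there the
  tile continues with an edge labeled \<open>b\<close>, which stays to the right of the path, so the
  next label is at most \<open>b\<close>; equality would make the tile \<open>tile u i\<close>. As
  the tiling is edge-to-edge, \<open>q\<close> is a vertex of every tile through it, and no second
  tile can have \<open>q\<close> as its left corner.\<close>

lemma next_corner_tile:
  assumes T: "partial_tiling u w T" and u: "u permutes {1..n}" and w: "w permutes {1..n}" and i: "i < n"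
    and b: "b \<in> {1..n}" "u (Suc i) < b" and R: "rhombus \<theta> (vertex u i) (u (Suc i)) b \<in> T"
    and none: "\<And>j. Suc j < n \<Longrightarrow> u (Suc j) < u (Suc (Suc j)) \<Longrightarrow> tile u j \<notin> T"
  shows "Suc i < n \<and> (\<exists>d\<in>{1..n}. u (Suc (Suc i)) < d \<and> rhombus \<theta> (vertex u (Suc i)) (u (Suc (Suc i))) d \<in> T)"
proof -
  define a where "a = u (Suc i)"
  define p where "p = vertex u i"
  define q where "q = vertex u (Suc i)"
  define R where "R = rhombus \<theta> p a b"
  have a: "a \<in> {1..n}" using permutes_label[OF u i] by (simp add: a_def)
  have ab: "a < b" using b by (simp add: a_def)
  have RT: "R \<in> T" using R by (simp add: R_def p_def a_def)
  have qp: "q = p + cis (\<theta> a)" by (simp add: q_def p_def a_def vertex_Suc)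
  have dq: "depth q = level u (Suc i)" by (simp add: q_def)
  have n: "0 < n" using i by simp
  have Rq: "Re q = path_x u (level u (Suc i))"
    using path_x_vertex[OF u, of "Suc i"] i by (simp add: q_def)
  have hb: "0 < height b" using height_pos b(1) .
  have along: "q + s *\<^sub>R cis (\<theta> b) \<in> R" if "0 \<le> s" "s \<le> 1" for s
    using parallelogramI[of 1 s p "cis (\<theta> a)" "cis (\<theta> b)"] that
    by (simp add: R_def rhombus_eq_parallelogram qp)
  have "q + cis (\<theta> b) \<in> R" using along[of 1] by simp
  then have "level u (Suc i) + height b \<le> total"
    using partial_tilingD(5)[OF T RT, of "q + cis (\<theta> b)"] dq by (simp add: add.commute)
  then have "Suc i \<noteq> n" using hb level_n[OF u] by auto
  then have Si: "Suc i < n" using i by simp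
  define c where "c = u (Suc (Suc i))"
  have c: "c \<in> {1..n}" using permutes_label[OF u Si] by (simp add: c_def)
  have hc: "0 < height c" using height_pos c .
  have "slope c \<le> slope b"
  proof -
    \<comment> \<open>Leads to a point of the edge labeled \<open>b\<close> no deeper than the end
      of the next edge of the path.\<close>
    define s where "s = min 1 (height c / height b)"
    have s: "0 < s" "s \<le> 1" "s * height b \<le> height c"
      using hb hc by (auto simp: s_def min_def field_simps)
    have "path_x u (level u (Suc i) + s * height b) = Re q + slope c * (s * height b)"
      using path_x_at[OF u Si, of "level u (Suc i) + s * height b"] s hb by (simp add: c_def q_def level_Suc)
    moreover have "path_x u (level u (Suc i) + s * height b) \<le> Re q + s * (slope b * height b)"
      using partial_tilingD(5)[OF T RT along[of s]] s dq Re_cis_slope[OF b(1)] by (simp del: cis.sel)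
    ultimately have "slope c * (s * height b) \<le> slope b * (s * height b)" by (simp add: algebra_simps)
    then show ?thesis using s hb by simp
  qed
  then have "c \<le> b" using slope_le_iff[OF c b(1)] by simp
  moreover have "c \<noteq> b"
    using none[OF Si] ab RT by (auto simp: R_def tile_def a_def c_def p_def)
  ultimately have cb: "c < b" by simp
  obtain e where e: "0 < e" "\<And>r. 0 < r \<Longrightarrow> r < e \<Longrightarrow> q + of_real r \<in> interior R"
    using left_corner_interior[OF a b(1) ab, of p] by (metis R_def qp)
  obtain r where r: "0 < r" "r < e" using e(1) dense by blast
  have "q + of_real r \<in> R" using e(2)[OF r] interior_subset by blast
  \<comment> \<open>The tile has positive width at the depth of \<open>q\<close>, so the paths are
    apart there, and by continuity also just below.\<close>
  then have "path_x u (level u (Suc i)) < path_x w (level u (Suc i))"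
    using partial_tilingD(5)[OF T RT, of "q + of_real r"] r(1) Rq dq by simp
  moreover have "open {y. path_x u y < path_x w y}"
    by (intro open_Collect_less continuous_path_x)
  ultimately obtain \<delta> where \<delta>: "0 < \<delta>" "ball (level u (Suc i)) \<delta> \<subseteq> {y. path_x u y < path_x w y}"
    using open_contains_ball by blast
  have gap: "path_x u y < path_x w y" if "level u (Suc i) < y" "y < level u (Suc i) + \<delta>" for y
  proof -
    have "y \<in> ball (level u (Suc i)) \<delta>" using that by (simp add: dist_real_def)
    then show ?thesis using \<delta>(2) by blast
  qed
  have "\<exists>d\<in>{1..n}. u (Suc (Suc i)) < d \<and> rhombus \<theta> q (u (Suc (Suc i))) d \<in> T"
  proof (rule corner_tile[OF T u Si q_def \<delta>(1) gap])
    fix p' a' b'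
    assume ab': "a' \<in> {1..n}" "b' \<in> {1..n}" "a' < b'" and S: "rhombus \<theta> p' a' b' \<in> T"
    {
      assume q: "q \<in> rhombus \<theta> p' a' b'"
      \<comment> \<open>\<open>q\<close> is extreme in \<open>R\<close>, hence in the intersection
        of the two tiles; as the intersection is a face of the other tile, \<open>q\<close> is
        extreme there too.\<close>
      have "closed_segment p q face_of R"
        unfolding R_def qp using rhombus_edge_faces(1)[OF a b(1)] ab by simp
      moreover have "{q} face_of closed_segment p q"
        by (simp add: face_of_singleton extreme_point_of_segment)
      ultimately have "{q} face_of R" using face_of_trans by blast
      moreover have "q \<in> R" using along[of 0] by simp
      ultimately have "{q} face_of (R \<inter> rhombus \<theta> p' a' b')"
        using q face_of_subset[of "{q}" R "R \<inter> rhombus \<theta> p' a' b'"] by simp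
      then have "{q} face_of rhombus \<theta> p' a' b'"
        using partial_tilingD(4)[OF T RT S] face_of_trans by blast
      then show "q \<in> {p', p' + cis (\<theta> a'), p' + cis (\<theta> b'), p' + cis (\<theta> a') + cis (\<theta> b')}"
        unfolding face_of_singleton rhombus_def by (rule extreme_point_of_convex_hull)
    }
    assume q: "q = p' + cis (\<theta> a')"
    obtain e' where e': "0 < e'" "\<And>r. 0 < r \<Longrightarrow> r < e' \<Longrightarrow> q + of_real r \<in> interior (rhombus \<theta> p' a' b')"
      using left_corner_interior[OF ab', of p'] by (metis q)
    define r where "r = min e e' / 2"
    have "0 < r" "r < e" "r < e'" using e(1) e'(1) by (auto simp: r_def min_def)
    then have "q + of_real r \<in> interior R \<inter> interior (rhombus \<theta> p' a' b')" using e(2) e'(2) by blast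
    then have "R = rhombus \<theta> p' a' b'" using partial_tilingD(3)[OF T RT S] by blast
    then have "b = b'" using rhombus_labels_unique(2)[OF a b(1) ab ab'] by (simp add: R_def)
    then show "u (Suc (Suc i)) < b'" using cb by (simp add: c_def)
  qed
  then show ?thesis using Si by (simp add: q_def)
qed

text \<open>Without such a tile, each tile hanging from a vertex of the path would yield one at the
  next vertex, past the last edge.\<close>

lemma exists_left_tile:
  assumes T: "partial_tiling u w T" and u: "u permutes {1..n}" and w: "w permutes {1..n}" and ne: "u \<noteq> w"
  shows "\<exists>j. Suc j < n \<and> u (Suc j) < u (Suc (Suc j)) \<and> tile u j \<in> T"
proof (rule ccontr)
  assume none: "\<not> ?thesis"
  define P where "P i \<longleftrightarrow> i < n \<and> (\<exists>b\<in>{1..n}. u (Suc i) < b \<and> rhombus \<theta> (vertex u i) (u (Suc i)) b \<in> T)" for i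
  obtain i where "P i" using first_corner_tile[OF T u w ne] by (auto simp: P_def)
  moreover have step: "P (Suc i)" if "P i" for i
    using next_corner_tile[OF T u w] that none unfolding P_def by metis
  ultimately have "P (i + k)" for k by (induction k) auto
  then have "i + n < n" unfolding P_def by blast
  then show False by simp
qed

lemma partial_tiling_remove:
  assumes T: "partial_tiling u w T" and u: "u permutes {1..n}"
    and j: "Suc j < n" and asc: "u (Suc j) < u (Suc (Suc j))" and R: "tile u j \<in> T"
  shows "partial_tiling (swap_at (Suc j) u) w (T - {tile u j})"
proof -
  define v where "v = swap_at (Suc j) u"
  note mem = tile_iff[OF u j asc, folded v_def]
  have v: "v permutes {1..n}" using swap_at_permutes[OF u, of "Suc j"] j by (simp add: v_def)
  have n: "0 < n" using j by simp
  have uv: "path_x u y \<le> path_x v y" if "0 \<le> y" "y \<le> total" for y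
    using path_x_weak_le(1)[OF u v _ that n] weak_le_swap_at[OF u _ j asc] by (simp add: v_def)
  have inside: "level u j \<le> y \<and> y \<le> level u (Suc (Suc j))" if "0 \<le> y" "y \<le> total" "path_x u y < path_x v y" for y
    using path_x_swap_at_outside[OF u j that(1,2)] that(3) by (fastforce simp: v_def)
  have strict: "{z. path_x u (depth z) < Re z \<and> Re z < path_x v (depth z) \<and> 0 \<le> depth z \<and> depth z \<le> total} \<subseteq> tile u j"
    using mem inside by fastforce
  \<comment> \<open>Where the swap moves the path, the moved point is in the removed tile and hence
    not beyond \<open>w\<close>.\<close>
  have vw: "path_x v y \<le> path_x w y" if y: "0 \<le> y" "y \<le> total" for y
  proof (cases "path_x u y < path_x v y")
    case True
    then have "Complex (path_x v y) (- y) \<in> tile u j"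
      using mem[of "Complex (path_x v y) (- y)"] inside[OF y True] by simp
    then show ?thesis using partial_tilingD(5)[OF T R] by fastforce
  next
    case False
    then show ?thesis using uv[OF y] partial_tilingD(7)[OF T y] by simp
  qed
  \<comment> \<open>A tile reaching across the new path would, as the closure of its interior, have
    an interior point there with a neighbourhood in the removed tile; the interiors would
    overlap.\<close>
  have right: "path_x v (depth z) \<le> Re z" if S: "S \<in> T" "S \<noteq> tile u j" and z: "z \<in> S" for S z
  proof (rule ccontr)
    assume beyond: "\<not> path_x v (depth z) \<le> Re z"
    obtain p a b where a: "a \<in> {1..n}" and b: "b \<in> {1..n}" and ab: "a < b" and Sr: "S = rhombus \<theta> p a b"
      using partial_tilingD(2)[OF T S(1)] by blast
    have Sin: "0 \<le> depth z \<and> depth z \<le> total \<and> path_x u (depth z) \<le> Re z" if "z \<in> S" for z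
      using partial_tilingD(5)[OF T S(1) that] by blast
    define U where "U = {z. Re z < path_x v (depth z)}"
    have openU: "open U" unfolding U_def by (intro open_Collect_less continuous_intros)
    have "closure (interior S) = closure S"
      using rhombus_interior_nonempty[OF a b ab, of p] unfolding Sr
      by (intro convex_closure_interior convex_rhombus)
    then have "z \<in> U \<inter> closure (interior S)"
      using z closure_subset[of S] beyond by (auto simp: U_def)
    then obtain x where x: "x \<in> U" "x \<in> interior S"
      using open_Int_closure_eq_empty[OF openU, of "interior S"] by blast
    define W where "W = U \<inter> interior S \<inter> {z. path_x u (depth z) < Re z}"
    have "open W" unfolding W_def using openU
      by (intro open_Int open_interior open_Collect_less continuous_intros)
    moreover have "W \<subseteq> tile u j"
    proof
      fix z assume "z \<in> W"
      then have "z \<in> S" "path_x u (depth z) < Re z" "Re z < path_x v (depth z)"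
        using interior_subset by (auto simp: W_def U_def)
      then show "z \<in> tile u j" using strict Sin by blast
    qed
    ultimately have "W \<subseteq> interior (tile u j)" by (rule interior_maximal[rotated])
    moreover have "x \<in> W"
      using x interior_right_of_path[of S u x] Sin by (simp add: W_def)
    ultimately show False
      using partial_tilingD(3)[OF T R S(1)] S(2) x(2) by blast
  qed
  show ?thesis
    unfolding partial_tiling_def v_def[symmetric]
  proof (intro conjI)
    show "finite (T - {tile u j})" using partial_tilingD(1)[OF T] by simp
    show "\<forall>R\<in>T - {tile u j}. \<exists>p. \<exists>a\<in>{1..n}. \<exists>b\<in>{1..n}. a < b \<and> R = rhombus \<theta> p a b"
      using partial_tilingD(2)[OF T] by simp
    show "pairwise (\<lambda>R S. interior R \<inter> interior S = {}) (T - {tile u j})"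
      using partial_tilingD(3)[OF T] by (simp add: pairwise_def)
    show "\<forall>R\<in>T - {tile u j}. \<forall>S\<in>T - {tile u j}. (R \<inter> S) face_of R \<and> (R \<inter> S) face_of S"
      using partial_tilingD(4)[OF T] by simp
    show "\<forall>R\<in>T - {tile u j}. R \<subseteq> region v w"
    proof (intro ballI subsetI)
      fix S z assume "S \<in> T - {tile u j}" "z \<in> S"
      then show "z \<in> region v w"
        using right[of S z] partial_tilingD(5)[OF T, of S z] by (simp add: region_def)
    qed
    show "{z. 0 \<le> depth z \<and> depth z \<le> total \<and> path_x v (depth z) < Re z \<and> Re z < path_x w (depth z)} \<subseteq> \<Union>(T - {tile u j})"
    proof
      fix z assume z: "z \<in> {z. 0 \<le> depth z \<and> depth z \<le> total \<and> path_x v (depth z) < Re z \<and> Re z < path_x w (depth z)}"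
      then obtain S where "S \<in> T" "z \<in> S"
        using partial_tilingD(6)[OF T, of z] uv[of "depth z"] by force
      moreover have "z \<notin> tile u j" using z mem[of z] by auto
      ultimately show "z \<in> \<Union>(T - {tile u j})" by blast
    qed
    show "\<forall>y. 0 \<le> y \<and> y \<le> total \<longrightarrow> path_x v y \<le> path_x w y" using vw by simp
  qed
qed

text \<open>Removing the tiles one by one is a chain of swaps, each of which creates an inversion.
  It cannot get stuck before \<open>w\<close>, as \<open>exists_left_tile\<close> provides a tile
  whenever \<open>u\<close> differs from \<open>w\<close>.\<close>

lemma partial_tiling_weak_le:
  assumes w: "w permutes {1..n}"
  shows "u permutes {1..n} \<Longrightarrow> partial_tiling u w T \<Longrightarrow> weak_le n u w"
proof (induction "card T" arbitrary: u T rule: less_induct)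
  case less
  note u = less.prems(1) and T = less.prems(2)
  show ?case
  proof (cases "u = w")
    case True
    then show ?thesis by (simp add: weak_le_refl)
  next
    case False
    obtain j where j: "Suc j < n" "u (Suc j) < u (Suc (Suc j))" "tile u j \<in> T"
      using exists_left_tile[OF T u w False] by blast
    have v: "swap_at (Suc j) u permutes {1..n}" using swap_at_permutes[OF u, of "Suc j"] j(1) by simp
    have "card (T - {tile u j}) < card T"
      using j(3) partial_tilingD(1)[OF T] by (rule card_Diff1_less[rotated])
    then have "weak_le n (swap_at (Suc j) u) w"
      using less.hyps v partial_tiling_remove[OF T u j] by blast
    then show ?thesis using weak_le_swap_at[OF u _ j(1,2)] weak_le_trans by simp
  qed
qed

text \<open>
  While the tiles are removed one by one, the labels \<open>k\<close> and \<open>k + 1\<close> keep their places until they are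
  swapped with each other: every other swap of one of them would invert \<open>k\<close> with a smaller label or
  \<open>k + 1\<close> with a larger one.
\<close>

lemma extremal_tile_in_tiling:
  assumes w: "w permutes {1..n}" and j: "Suc j < n"
    and inv: "inv w (Suc (Suc j)) < inv w (Suc j)"
    and mx: "left_to_right_maximum n w (Suc (Suc j))" and mn: "right_to_left_minimum n w (Suc j)"
  shows "u permutes {1..n} \<Longrightarrow> partial_tiling u w T \<Longrightarrow> u ` {1..j} = {1..j} \<Longrightarrow> u (Suc j) = Suc j \<Longrightarrow>
    u (Suc (Suc j)) = Suc (Suc j) \<Longrightarrow> vertex u j = vertex id j \<Longrightarrow> tile id j \<in> T"
proof (induction "card T" arbitrary: u T rule: less_induct)
  case less
  note u = less.prems(1) and T = less.prems(2) and pre = less.prems(3) and at = less.prems(4,5) and ve = less.prems(6)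
  have jn: "Suc j \<in> {1..n}" "Suc (Suc j) \<in> {1..n}" using j by auto
  have uw: "weak_le n u w" by (rule partial_tiling_weak_le[OF w u T])
  have iu: "inv u (u x) = x" for x by (simp add: permutes_inverses(2)[OF u])
  have "u \<noteq> w"
  proof
    assume "u = w"
    then have "inv w (Suc j) = Suc j" "inv w (Suc (Suc j)) = Suc (Suc j)"
      using iu[of "Suc j"] iu[of "Suc (Suc j)"] at by simp_all
    then show False using inv by simp
  qed
  then obtain i where i: "Suc i < n" "u (Suc i) < u (Suc (Suc i))" "tile u i \<in> T"
    using exists_left_tile[OF T u w] by blast
  define v where "v = swap_at (Suc i) u"
  have v: "v permutes {1..n}" using swap_at_permutes[OF u, of "Suc i"] i(1) by (simp add: v_def)
  have T': "partial_tiling v w (T - {tile u i})" unfolding v_def by (rule partial_tiling_remove[OF T u i])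
  have vw: "weak_le n v w" by (rule partial_tiling_weak_le[OF w v T'])
  have lt: "card (T - {tile u i}) < card T"
    using i(3) partial_tilingD(1)[OF T] by (rule card_Diff1_less[rotated])
  \<comment> \<open>The swap creates this inversion in \<open>v\<close>, and \<open>v\<close> is
    still below \<open>w\<close>.\<close>
  have swapped: "inv w (u (Suc (Suc i))) < inv w (u (Suc i))"
  proof -
    have "inv v (u (Suc (Suc i))) = Suc i" "inv v (u (Suc i)) = Suc (Suc i)"
      by (simp_all add: v_def inv_swap_at[OF u] iu)
    then show ?thesis
      using weak_leD[OF vw _ _ i(2)] permutes_label[OF u] i(1) by simp
  qed
  have lab: "u (Suc i) \<in> {1..n}" "u (Suc (Suc i)) \<in> {1..n}" using permutes_label[OF u] i(1) by simp_all
  \<comment> \<open>The swap exchanges positions \<open>Suc i\<close> and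
    \<open>Suc (Suc i)\<close>; of the positions \<open>Suc j\<close> and \<open>Suc (Suc j)\<close>
    it involves both, the first, the second or none.\<close>
  consider "i = j" | "Suc i = j" | "i = Suc j" | "i \<noteq> j" "Suc i \<noteq> j" "i \<noteq> Suc j" by blast
  then show ?case
  proof cases
    case 1
    then have "tile u i = tile id j" using at ve by (simp add: tile_def)
    then show ?thesis using i(3) by simp
  next
    case 2
    then have "u (Suc (Suc i)) = Suc j" using at by simp
    moreover from this have "u (Suc i) < Suc j" using i(2) by simp
    ultimately show ?thesis
      using swapped mn lab right_to_left_minimum_alt[OF w jn(1)] by force
  next
    case 3
    then have "u (Suc i) = Suc (Suc j)" using at by simp
    moreover from this have "Suc (Suc j) < u (Suc (Suc i))" using i(2) by simp
    ultimately show ?thesis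
      using swapped mx lab left_to_right_maximum_alt[OF w jn(2)] by force
  next
    case 4
    \<comment> \<open>A swap above the tile permutes the prefix within itself, and one below leaves
      it alone.\<close>
    have "v ` {1..j} = {1..j}"
    proof (cases "i < j")
      case True
      then have "Transposition.transpose (Suc i) (Suc (Suc i)) ` {1..j} = {1..j}"
        using 4 by (intro permutes_image permutes_swap_id) auto
      then show ?thesis unfolding v_def swap_at_def image_comp[symmetric] using pre by simp
    next
      case False
      then have "v ` {1..j} = u ` {1..j}"
        using 4 by (intro image_cong) (auto simp: v_def swap_at_def Transposition.transpose_def)
      then show ?thesis using pre by simp
    qed
    moreover have "v (Suc j) = Suc j" "v (Suc (Suc j)) = Suc (Suc j)"
      using 4 at swap_at_values(3)[of j i u] swap_at_values(3)[of "Suc j" i u] by (auto simp: v_def)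
    moreover have "vertex v j = vertex id j"
      using 4 ve vertex_swap_at[of j i u] by (simp add: v_def)
    ultimately have "tile id j \<in> T - {tile u i}" using less.hyps[OF lt v T'] by blast
    then show ?thesis by simp
  qed
qed

lemma tiling_is_partial_tiling:
  assumes w: "w permutes {1..n}" and fs: "fully_supported n w" and n: "2 \<le> n"
    and T: "T \<in> rhombic_tilings n \<theta> w"
  shows "partial_tiling id w T"
proof -
  have U: "\<Union>T = region id w"
    using T elnitsky_polygon_region[OF w fs n] by (simp add: rhombic_tilings_def)
  have "\<exists>p. \<exists>a\<in>{1..n}. \<exists>b\<in>{1..n}. a < b \<and> R = rhombus \<theta> p a b" if "R \<in> T" for R
  proof -
    have "\<exists>i j. tile_with_labels n \<theta> i j R" using T that by (simp add: rhombic_tilings_def)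
    then obtain i j p where "i \<in> {1..n}" "j \<in> {1..n}" "i \<noteq> j" "R = rhombus \<theta> p i j"
      unfolding tile_with_labels_def by blast
    then show ?thesis using rhombus_commute[of \<theta> p i j] by (metis linorder_neqE_nat)
  qed
  moreover have "path_x id y \<le> path_x w y" if "0 \<le> y" "y \<le> total" for y
    using path_x_weak_le(1)[OF permutes_id w weak_le_id that] n by simp
  ultimately show ?thesis
    using T U unfolding partial_tiling_def rhombic_tilings_def by (auto simp: region_def)
qed

lemma extremal_imp_forced:
  assumes w: "w permutes {1..n}" and fs: "fully_supported n w" and k: "1 \<le> k" "k < n"
    and mx: "left_to_right_maximum n w (Suc k)" and mn: "right_to_left_minimum n w k"
  shows "forced_left_perimeter_tile n \<theta> w k (Suc k)"
  unfolding forced_left_perimeter_tile_def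
proof
  fix T assume T: "T \<in> rhombic_tilings n \<theta> w"
  define j where "j = k - 1"
  have kj: "k = Suc j" using k by (simp add: j_def)
  have n: "2 \<le> n" using k by simp
  note id = permutes_id[of "{1..n}"]
  have inv: "inv w (Suc k) < inv w k" by (rule maximum_minimum_inverted[OF w fs k mx mn])
  have j: "Suc j < n" using k kj by simp
  have "tile id j \<in> T"
    using extremal_tile_in_tiling[OF w j _ _ _ id tiling_is_partial_tiling[OF w fs n T]] inv mx mn by (simp add: kj)
  moreover have "tile_with_labels n \<theta> k (Suc k) (tile id j)"
    using k by (auto simp: tile_with_labels_def tile_def kj)
  moreover have "path_edge \<theta> id (Suc i) edge_of tile id j" if "i = j \<or> i = Suc j" for i
  proof -
    have "aff_dim (path_edge \<theta> id (Suc i)) = 1"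
      using vertex_neq[OF id, of i] that j
      by (auto simp: path_edge_Suc segment_convex_hull aff_dim_convex_hull)
    then show ?thesis using tile_edge_face[OF id j that] by (simp add: edge_of_def)
  qed
  then have "left_perimeter_tile n \<theta> (tile id j)"
    unfolding left_perimeter_tile_def using j by (intro exI[of _ "Suc j"]) simp
  ultimately show "\<exists>R\<in>T. tile_with_labels n \<theta> k (Suc k) R \<and> left_perimeter_tile n \<theta> R" by blast
qed

end

theorem corollary4p10:
  fixes n k :: nat and w :: "nat \<Rightarrow> nat" and \<theta> :: "nat \<Rightarrow> real"
  assumes "n \<ge> 2"
    and "w permutes {1..n}"
    and "fully_supported n w"
    and "admissible_angles n \<theta>"
    and "1 \<le> k" and "k \<le> n - 1"
  shows "(forced_left_perimeter_tile n \<theta> w k (k + 1) \<longleftrightarrow>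
            inv w k > inv w (k + 1) \<and> \<not> together_in_321 n w k (k + 1)) \<and>
         (inv w k > inv w (k + 1) \<and> \<not> together_in_321 n w k (k + 1) \<longleftrightarrow>
            left_to_right_maximum n w (k + 1) \<and> right_to_left_minimum n w k)"
proof -
  interpret angles n \<theta> by unfold_locales (rule assms(4))
  have k: "1 \<le> k" "k < n" using assms by auto
  show ?thesis
    using inverted_avoiding_321_iff[OF assms(2,3) k] forced_imp_inverted_avoiding_321[OF assms(2,3) k]
      extremal_imp_forced[OF assms(2,3) k]
    by auto
qed

end
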